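(* Let $n,s$ be positive integers with $s\le n$. The set $\mathcal P_{\min}(n,s)$ is an $(n,s)$-Vandermonde covering of size $\left|\mathcal P\left(n-\left\lceil\frac s2\right\rceil,\left\lfloor\frac s2\right\rfloor\right)\right|$.
   Context: A univariate real polynomial is hyperbolic if all its roots are real; $\mathcal H$ is the set of monic hyperbolic polynomials of degree $n$ in $\mathbb R[T]$. For $F=T^n+F_1T^{n-1}+\dots+F_n\in\mathcal H$, the hyperbolic slice is $\mathcal H_s(F)=\{T^n+H_1T^{n-1}+\dots+H_n\in\mathcal H : H_i=F_i \text{ for } 1\le i\le s\}$. It is generic if it contains no polynomial with at most $s-1$ distinct roots. $H\in\mathcal H_s(F)$ is minimal if its coefficient $H_{s+1}$ of $T^{n-s-1}$ satisfies $H_{s+1}\le G_{s+1}$ for all $G=T^n+G_1T^{n-1}+\dots+G_n\in\mathcal H_s(F)$ (if $s=n$ then $\mathcal H_s(F)=\{F\}$ and $F$ is regarded as minimal). $\mathcal P(m,r)$ is the set of partitions of $m$ into $r$ (positive) parts. For $G\in\mathcal H$, $p(G)$ is the partition of $n$ formed by the multiplicities of the distinct roots of $G$. For partitions $p,q$ of $n$, $p\le q$ means that $p$ can be obtained from $q$ by summing some of the parts of $q$ and then reordering (i.e. by grouping the parts of $q$ and replacing each group by its sum). $\mathcal P_{\min}(n,s)\subseteq\mathcal P(n,s)$ is the set of partitions of $n$ into $s$ parts that correspond to a minimal polynomial in some generic hyperbolic slice, i.e. that are of the form $p(H)$ with $H$ the minimal polynomial of a generic $\mathcal H_s(F)$.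 A set $P\subseteq\mathcal P(n,s)$ is an $(n,s)$-Vandermonde covering if for every hyperbolic slice $\mathcal H_s(F)$, $F\in\mathcal H$, there are $q\in P$ and $G\in\mathcal H_s(F)$ with $q\ge p(G)$.
   Formalization: The covering claim is stated only when s ≥ 2 or n = s = 1: for s = 1 < n the coefficient H_2 is unbounded below on every slice, so no minimal polynomial exists, P_min(n,1) is empty and is not a covering; the size claim is kept for all 1 ≤ s ≤ n. *)

theory Defs
  imports "HOL-Analysis.Analysis" "HOL-Computational_Algebra.Computational_Algebra"
begin

definition hyperbolic :: "real poly \<Rightarrow> bool" where
  "hyperbolic p \<longleftrightarrow> (\<forall>z::complex. poly (map_poly of_real p) z = 0 \<longrightarrow> z \<in> \<real>)"

definition hyperbolic_polys :: "nat \<Rightarrow> real poly set" where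
  "hyperbolic_polys n = {p. degree p = n \<and> lead_coeff p = 1 \<and> hyperbolic p}"

text \<open>In the notation \<open>T\<^sup>n + F\<^sub>1 T\<^sup>n\<^sup>-\<^sup>1 + \<dots> + F\<^sub>n\<close>, the number \<open>F\<^sub>i\<close> is \<open>coeff F (n - i)\<close>.\<close>

definition hyperbolic_slice :: "nat \<Rightarrow> nat \<Rightarrow> real poly \<Rightarrow> real poly set" where
  "hyperbolic_slice n s F =
     {H \<in> hyperbolic_polys n. \<forall>i\<in>{1..s}. coeff H (n - i) = coeff F (n - i)}"

text \<open>Elements of a slice have only real roots, so counting real roots counts all roots.\<close>

definition generic_slice :: "nat \<Rightarrow> nat \<Rightarrow> real poly \<Rightarrow> bool" where
  "generic_slice n s F \<longleftrightarrow> (\<forall>G\<in>hyperbolic_slice n s F. \<not> card {x. poly G x = 0} \<le> s - 1)"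

text \<open>For \<open>s = n\<close> the slice of \<open>F\<close> is \<open>{F}\<close> and its only element counts as minimal.\<close>

definition minimal_in_slice :: "nat \<Rightarrow> nat \<Rightarrow> real poly \<Rightarrow> real poly \<Rightarrow> bool" where
  "minimal_in_slice n s F H \<longleftrightarrow> H \<in> hyperbolic_slice n s F \<and>
     (s < n \<longrightarrow> (\<forall>G\<in>hyperbolic_slice n s F. coeff H (n - (s + 1)) \<le> coeff G (n - (s + 1))))"

definition partitions_into :: "nat \<Rightarrow> nat \<Rightarrow> nat multiset set" where
  "partitions_into m r = {p. (\<forall>k\<in>#p. 0 < k) \<and> sum_mset p = m \<and> size p = r}"

definition root_partition :: "real poly \<Rightarrow> nat multiset" where
  "root_partition G = image_mset (\<lambda>x. order x G) (mset_set {x. poly G x = 0})"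

text \<open>\<open>p \<le> q\<close> for partitions: \<open>M\<close> is a grouping of the parts of \<open>q\<close> into nonempty groups,
  and \<open>p\<close> consists of the sums of the groups.\<close>

definition partition_le :: "nat multiset \<Rightarrow> nat multiset \<Rightarrow> bool" where
  "partition_le p q \<longleftrightarrow> (\<exists>M :: nat multiset multiset.
     {#} \<notin># M \<and> sum_mset M = q \<and> image_mset sum_mset M = p)"

definition P_min :: "nat \<Rightarrow> nat \<Rightarrow> nat multiset set" where
  "P_min n s = {p \<in> partitions_into n s.
     \<exists>F\<in>hyperbolic_polys n. generic_slice n s F \<and>
       (\<exists>H. minimal_in_slice n s F H \<and> p = root_partition H)}"

definition vandermonde_covering :: "nat \<Rightarrow> nat \<Rightarrow> nat multiset set \<Rightarrow> bool" where
  "vandermonde_covering n s P \<longleftrightarrow> P \<subseteq> partitions_into n s \<and>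
     (\<forall>F\<in>hyperbolic_polys n. \<exists>q\<in>P. \<exists>G\<in>hyperbolic_slice n s F. partition_le (root_partition G) q)"

text \<open>For \<open>s = 1 < n\<close> the coefficient \<open>H\<^sub>2\<close> is unbounded below on every slice, so there are no
  minimal polynomials and \<open>P_min n 1\<close> is empty. Hence it is not a covering in this case.\<close>

lemma map_poly_of_real_mult:
  "map_poly of_real (p * q) = (map_poly of_real p * map_poly of_real q :: complex poly)"
  by (intro poly_eqI) (simp add: coeff_map_poly coeff_mult)

lemma hyperbolic_mult: "hyperbolic p \<Longrightarrow> hyperbolic q \<Longrightarrow> hyperbolic (p * q)"
  by (auto simp: hyperbolic_def map_poly_of_real_mult)

lemma hyperbolic_linear: "hyperbolic [:a, 1:]"
proof -
  have "z \<in> \<real>" if "of_real a + z = 0" for z :: complex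
    using that by (metis Reals_minus_iff Reals_of_real add_eq_0_iff)
  then show ?thesis by (auto simp: hyperbolic_def map_poly_pCons)
qed

lemma hyperbolic_linear_power: "hyperbolic ([:a, 1:] ^ k)"
proof (induction k)
  case 0
  show ?case by (simp add: hyperbolic_def)
next
  case (Suc k)
  then show ?case using hyperbolic_mult[OF hyperbolic_linear] by simp
qed

lemma not_minimal_in_slice_1:
  assumes n: "2 \<le> n" and H: "minimal_in_slice n 1 F H"
  shows False
proof -
  define c where "c = coeff F (n - 1) / n"
  define L where "L = [:c, 1:] ^ (n - 2)"
  define G where "G t = L * [:c - t, 1:] * [:c + t, 1:]" for t
  have n_eq: "n = Suc (Suc (n - 2))" using n by simp
  have G_eq: "G t = [:c, 1:] ^ n - smult (t\<^sup>2) L" for t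
  proof -
    have "[:c, 1:] ^ n = L * ([:c, 1:] * [:c, 1:])"
      by (subst n_eq) (simp only: L_def power_Suc2 mult.assoc)
    moreover have "[:c - t, 1:] * [:c + t, 1:] = [:c, 1:] * [:c, 1:] - smult (t\<^sup>2) 1"
      by (simp add: power2_eq_square algebra_simps one_pCons)
    ultimately show ?thesis
      by (simp only: G_def mult.assoc right_diff_distrib mult_smult_right mult_1_right)
  qed
  have deg_L: "degree L = n - 2" by (simp add: L_def degree_linear_power)
  have L: "coeff L (n - 1) = 0" "coeff L (n - 2) = 1"
    using n deg_L by (auto simp: L_def coeff_linear_poly_power intro!: coeff_eq_0)
  have G_slice: "G t \<in> hyperbolic_slice n 1 F" for t
  proof -
    have monic: "lead_coeff (G t) = 1"
      by (simp only: G_def L_def lead_coeff_mult lead_coeff_power) simp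
    have "degree (G t) = n"
      using n by (simp add: G_def L_def degree_mult_eq degree_linear_power
                       del: mult_pCons_left mult_pCons_right)
    moreover have "hyperbolic (G t)"
      unfolding G_def L_def
      by (intro hyperbolic_mult hyperbolic_linear hyperbolic_linear_power)
    moreover have "coeff (G t) (n - 1) = coeff F (n - 1)"
    proof -
      have "n choose (n - 1) = n" using n binomial_symmetric[of 1 n] by simp
      then show ?thesis
        using n L(1) by (simp add: G_eq coeff_linear_poly_power c_def)
    qed
    ultimately show ?thesis
      using monic by (simp add: hyperbolic_slice_def hyperbolic_polys_def)
  qed
  define K where "K = coeff ([:c, 1:] ^ n) (n - 2) - coeff H (n - 2)"
  have "t\<^sup>2 \<le> K" for t :: real
  proof -
    have "coeff H (n - 2) \<le> coeff (G t) (n - 2)"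
      using H G_slice[of t] n
      by (auto simp: minimal_in_slice_def numeral_2_eq_2)
    then show ?thesis by (simp add: G_eq L K_def)
  qed
  from this[of "\<bar>K\<bar> + 1"] show False
    by (simp add: power2_eq_square algebra_simps) (smt (verit) zero_le_mult_iff)
qed

lemma not_vandermonde_covering_P_min_1:
  assumes "2 \<le> n"
  shows "P_min n 1 = {}" "\<not> vandermonde_covering n 1 (P_min n 1)"
proof -
  show empty: "P_min n 1 = {}"
    using not_minimal_in_slice_1[OF assms] by (auto simp: P_min_def)
  have "[:0, 1:] ^ n \<in> hyperbolic_polys n"
    using hyperbolic_linear_power[of 0 n]
    by (simp add: hyperbolic_polys_def degree_linear_power coeff_linear_poly_power)
  then show "\<not> vandermonde_covering n 1 (P_min n 1)"
    unfolding empty by (auto simp: vandermonde_covering_def)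
qed

end

theory Submission
  imports Defs
begin

text \<open>
  Everything is read off from the sorted roots \<open>z\<close> of a polynomial. By Newton's identities, fixing
  the first \<open>s\<close> coefficients is the same as fixing the power sums of order \<open>1, \<dots>, s\<close> of the roots,
  and on a slice a smaller next coefficient means a larger power sum of order \<open>s + 1\<close>. The proof
  identifies \<open>P_min n s\<close> with the set of partitions of \<open>n\<close> into \<open>s\<close> parts of which at least half
  are equal to one (\<open>P_min_eq\<close>). Removing \<open>\<lceil>s/2\<rceil>\<close> ones from such a partition gives the cardinality.

  A minimal polynomial has many simple roots (\<open>minimal_in_slice_card_roots\<close>). Write \<open>G = U W\<close> with \<open>U\<close>
  a monic divisor of degree \<open>s + 1\<close> whose roots are simple or double. Then \<open>(U - \<epsilon>) W\<close> lies in the same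
  slice and has a smaller next coefficient, and it is hyperbolic for small \<open>\<epsilon> > 0\<close> as soon as \<open>U\<close> is
  positive on both sides of each of its double roots. If \<open>G\<close> has \<open>k\<close> distinct roots, \<open>\<sigma>\<close> of them
  simple, such a \<open>U\<close> exists unless \<open>k \<le> s\<close> and \<open>2 k \<le> s + 2 \<sigma>\<close>. For \<open>k = s\<close> this says
  that at least half of the roots are simple. For \<open>k < s\<close> it suffices to refine the root partition,
  by splitting off ones, to a partition with \<open>s\<close> parts and at least half of them equal to one.
  Minimal polynomials exist in all slices with \<open>2 \<le> s < n\<close>, and for \<open>s = n\<close> the two inequalities
  hold for every hyperbolic polynomial; so the covering property follows.

  Conversely, let \<open>H\<close> have \<open>s\<close> distinct roots of which every second one, starting from the largest,
  is simple. A polynomial \<open>q\<close> of degree \<open>s\<close> whose roots are placed at the possibly multiple roots of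
  \<open>H\<close>, between them and next to the outermost ones, has an antiderivative that grows on every step from a root of \<open>H\<close> to the
  corresponding root of another member \<open>G\<close> of the slice. Summing over the roots compares the power
  sums of order \<open>s + 1\<close> and shows that \<open>H\<close> is minimal
  (\<open>power_sum_less_of_alternating_simple_roots\<close>). It remains to choose \<open>H\<close> with prescribed
  multiplicities such that its slice is generic. Once the power sums of order less than \<open>s\<close> are fixed,
  polynomials with fewer than \<open>s\<close> distinct roots realise only finitely many values of the power sum of
  order \<open>s\<close> (\<open>finite_power_sums_few_distinct\<close>), whereas \<open>H\<close> can realise a whole interval of values
  (\<open>weighted_power_sums_reach_nearby_values\<close>).
\<close>

section \<open>Hyperbolic polynomials as products of linear factors\<close>

definition roots_poly :: "nat \<Rightarrow> (nat \<Rightarrow> real) \<Rightarrow> real poly" where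
  "roots_poly n z = (\<Prod>i<n. [:- z i, 1:])"

definition power_sum :: "nat \<Rightarrow> (nat \<Rightarrow> real) \<Rightarrow> nat \<Rightarrow> real" where
  "power_sum n z k = (\<Sum>i<n. z i ^ k)"

lemma degree_roots_poly: "degree (roots_poly n z) = n"
  by (simp add: roots_poly_def degree_prod_eq_sum_degree)

lemma lead_coeff_roots_poly: "lead_coeff (roots_poly n z) = 1"
  by (simp add: roots_poly_def lead_coeff_prod)

lemma hyperbolic_prod: "(\<And>i. i \<in> I \<Longrightarrow> hyperbolic (f i)) \<Longrightarrow> hyperbolic (\<Prod>i\<in>I. f i)"
proof (induction I rule: infinite_finite_induct)
  case (insert i I)
  then show ?case by (simp add: hyperbolic_mult)
qed (simp_all add: hyperbolic_def)

lemma roots_poly_in_hyperbolic_polys: "roots_poly n z \<in> hyperbolic_polys n"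
  unfolding hyperbolic_polys_def
  using degree_roots_poly lead_coeff_roots_poly
  by (auto simp: roots_poly_def intro!: hyperbolic_prod hyperbolic_linear)

lemma poly_roots_poly: "poly (roots_poly n z) t = (\<Prod>i<n. t - z i)"
  by (simp add: roots_poly_def poly_prod)

lemma roots_poly_zeros: "{t. poly (roots_poly n z) t = 0} = z ` {..<n}"
  by (auto simp: poly_roots_poly)

lemma roots_poly_nonzero: "roots_poly n z \<noteq> 0"
  using lead_coeff_roots_poly[of n z] by auto

lemma order_roots_poly: "order t (roots_poly n z) = card {i. i < n \<and> z i = t}"
proof (induction n)
  case 0
  show ?case by (simp add: roots_poly_def order_0I)
next
  case (Suc n)
  have *: "roots_poly (Suc n) z = roots_poly n z * [:- z n, 1:]"
    by (simp only: roots_poly_def prod.lessThan_Suc)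
  have "order t [:- z n, 1:] = (if z n = t then 1 else 0)"
    using order_power_n_n[of t 1] by (auto intro!: order_0I)
  moreover have "{i. i < Suc n \<and> z i = t} =
      {i. i < n \<and> z i = t} \<union> (if z n = t then {n} else {})"
    by (auto simp: less_Suc_eq)
  moreover have "card \<dots> = card {i. i < n \<and> z i = t} + (if z n = t then 1 else 0)"
    by auto
  moreover have "order t (roots_poly (Suc n) z) = order t (roots_poly n z) + order t [:- z n, 1:]"
    using roots_poly_nonzero[of "Suc n" z] unfolding * by (rule order_mult)
  ultimately show ?case using Suc by simp
qed

lemma hyperbolic_factor: "hyperbolic (p * q) \<Longrightarrow> hyperbolic p"
  by (auto simp: hyperbolic_def map_poly_of_real_mult)

lemma poly_map_of_real: "poly (map_poly of_real p) (of_real x :: complex) = of_real (poly p x)"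
  by (induction p) (auto simp: map_poly_pCons)

lemma hyperbolic_poly_has_root:
  assumes "hyperbolic p" "degree p \<noteq> 0"
  obtains x where "poly p x = 0"
proof -
  have "degree (map_poly of_real p :: complex poly) = degree p"
    by (intro degree_map_poly) auto
  then have "\<not> constant (poly (map_poly of_real p :: complex poly))"
    using assms(2) by (simp add: constant_degree)
  from fundamental_theorem_of_algebra[OF this]
  obtain z where z: "poly (map_poly of_real p) z = (0::complex)" by blast
  with assms(1) obtain x where "z = of_real x" by (auto simp: hyperbolic_def elim: Reals_cases)
  with z have "poly p x = 0" by (simp add: poly_map_of_real)
  then show ?thesis by (rule that)
qed

text \<open>Remove one root at a time. The fundamental theorem of algebra provides a complex root, which is real
  by hyperbolicity, and the cofactor is again hyperbolic.\<close>
lemma hyperbolic_polys_split: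
  assumes "G \<in> hyperbolic_polys n"
  shows "\<exists>z. G = roots_poly n z"
  using assms
proof (induction n arbitrary: G)
  case 0
  then have "degree G = 0" "lead_coeff G = 1" by (auto simp: hyperbolic_polys_def)
  then have "G = 1" by (auto elim!: degree_eq_zeroE simp: one_pCons)
  then show ?case by (simp add: roots_poly_def)
next
  case (Suc n)
  then have G: "degree G = Suc n" "lead_coeff G = 1" "hyperbolic G"
    by (auto simp: hyperbolic_polys_def)
  have "degree G \<noteq> 0" using G(1) by simp
  then obtain x where "poly G x = 0" using hyperbolic_poly_has_root[OF G(3)] by blast
  then obtain Q where Q: "G = [:- x, 1:] * Q" unfolding poly_eq_0_iff_dvd by (rule dvdE)
  have "Q \<noteq> 0" using G(1) unfolding Q by (metis degree_0 mult_zero_right nat.distinct(1))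
  then have "degree ([:- x, 1:] * Q) = Suc (degree Q)"
    by (subst degree_mult_eq) auto
  then have "degree Q = n" using G(1) unfolding Q by linarith
  moreover have "lead_coeff Q = 1" using G(2) unfolding Q lead_coeff_mult by simp
  moreover have "hyperbolic Q"
    using G(3) hyperbolic_factor[of Q "[:- x, 1:]"] unfolding Q by (simp only: mult.commute)
  ultimately have "Q \<in> hyperbolic_polys n" by (simp add: hyperbolic_polys_def)
  then obtain z where z: "Q = roots_poly n z" using Suc.IH by blast
  have "roots_poly (Suc n) (z(n := x)) = [:- x, 1:] * (\<Prod>i<n. [:- (z(n := x)) i, 1:])"
    by (simp only: roots_poly_def prod.lessThan_Suc fun_upd_same mult.commute)
  also have "(\<Prod>i<n. [:- (z(n := x)) i, 1:]) = Q"
    unfolding z roots_poly_def by (intro prod.cong) auto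
  finally show ?case using Q by metis
qed

text \<open>The monotone enumeration makes it possible to match the roots of two polynomials index by index.\<close>
lemma hyperbolic_polys_sorted:
  assumes "G \<in> hyperbolic_polys n"
  obtains z where "mono_on {..<n} z" "G = roots_poly n z"
proof -
  obtain z where z: "G = roots_poly n z" using hyperbolic_polys_split[OF assms] by blast
  define zs where "zs = sort (map z [0..<n])"
  have len: "length zs = n" by (simp add: zs_def)
  have 1: "roots_poly n y = prod_list (map (\<lambda>t. [:- t, 1:]) ys)"
    if "length ys = n" "\<And>i. i < n \<Longrightarrow> ys ! i = y i" for y ys
    using that by (simp add: roots_poly_def prod.list_conv_set_nth atLeast0LessThan)
  have "mset (map (\<lambda>t. [:- t, 1:]) zs) = mset (map (\<lambda>t. [:- t, 1:]) (map z [0..<n]))"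
    by (simp add: zs_def mset_map[symmetric] del: mset_map map_map)
       (metis mset_map mset_sort)
  then have "prod_list (map (\<lambda>t. [:- t, 1:]) zs) = prod_list (map (\<lambda>t. [:- t, 1:]) (map z [0..<n]))"
    by (metis prod_mset_prod_list)
  then have "G = roots_poly n (\<lambda>i. zs ! i)"
    using z 1[of zs "\<lambda>i. zs ! i"] 1[of "map z [0..<n]" z] len by simp
  moreover have "mono_on {..<n} (\<lambda>i. zs ! i)"
    using len by (auto simp: monotone_on_def zs_def intro!: sorted_nth_mono)
  ultimately show ?thesis using that by blast
qed

lemma root_partition_roots_poly:
  "root_partition (roots_poly n z) = image_mset (\<lambda>t. card {i. i < n \<and> z i = t}) (mset_set (z ` {..<n}))"
  unfolding root_partition_def roots_poly_zeros order_roots_poly ..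

lemma root_partition_in_partitions:
  assumes "G \<in> hyperbolic_polys n"
  shows "root_partition G \<in> partitions_into n (card {x. poly G x = 0})"
proof -
  obtain z where z: "G = roots_poly n z" using hyperbolic_polys_split[OF assms] by blast
  have "(\<Sum>t\<in>z ` {..<n}. card {i. i < n \<and> z i = t}) = n"
    using sum.image_gen[of "{..<n}" "\<lambda>_. 1::nat" z] by (simp add: lessThan_def Collect_conj_eq)
  then show ?thesis
    by (force simp: z root_partition_roots_poly partitions_into_def roots_poly_zeros
        sum_unfold_sum_mset card_gt_0_iff)
qed

section \<open>Coefficients and power sums\<close>

text \<open>The elementary symmetric polynomials of the roots, with the signs that make them the coefficients
  of \<open>T\<^sup>n\<^sup>-\<^sup>k\<close>. The generating function is the reversed polynomial, which is convenient for logarithmic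
  differentiation.\<close>
definition esym :: "nat \<Rightarrow> (nat \<Rightarrow> real) \<Rightarrow> nat \<Rightarrow> real" where
  "esym n z k = fps_nth (\<Prod>i<n. 1 - fps_const (z i) * fps_X) k"

lemma coeff_roots_poly:
  assumes "k \<le> n" shows "coeff (roots_poly n z) (n - k) = esym n z k"
proof -
  have "fps_of_poly (reflect_poly (roots_poly n z)) = (\<Prod>i<n. 1 - fps_const (z i) * fps_X)"
    unfolding roots_poly_def reflect_poly_prod fps_of_poly_prod
    by (intro prod.cong) (auto simp: reflect_poly_def cCons_def fps_of_poly_pCons fps_const_neg[symmetric] simp del: fps_const_neg)
  then have "esym n z k = coeff (reflect_poly (roots_poly n z)) k"
    by (simp add: esym_def flip: fps_of_poly_nth)
  then show ?thesis using assms by (simp add: coeff_reflect_poly degree_roots_poly)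
qed

text \<open>The logarithmic derivative of \<open>\<Prod> (1 - z\<^sub>i T)\<close> is minus the generating function of the power sums;
  multiplying out and comparing coefficients gives the identities.\<close>
lemma newton_identity:
  "real m * esym n z m = - (\<Sum>i<m. esym n z i * power_sum n z (m - i))"
proof (cases m)
  case 0
  then show ?thesis by simp
next
  case (Suc k)
  define E where "E n = (\<Prod>i<n. 1 - fps_const (z i) * fps_X)" for n
  define P where "P n = Abs_fps (\<lambda>k. power_sum n z (Suc k))" for n
  have geom: "(1 - fps_const c * fps_X) * Abs_fps (\<lambda>k. c ^ Suc k) = fps_const c" for c :: real
  proof (rule fps_ext)
    fix k
    show "fps_nth ((1 - fps_const c * fps_X) * Abs_fps (\<lambda>k. c ^ Suc k)) k = fps_nth (fps_const c) k"
      by (cases k) (simp_all add: left_diff_distrib mult.assoc)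
  qed
  have "fps_deriv (E n) = - (E n * P n)"
  proof (induction n)
    case 0
    show ?case by (simp add: E_def P_def power_sum_def fps_zero_def)
  next
    case (Suc n)
    have E: "E (Suc n) = E n * (1 - fps_const (z n) * fps_X)" by (simp add: E_def)
    have P: "P (Suc n) = P n + Abs_fps (\<lambda>k. z n ^ Suc k)"
      by (rule fps_ext) (simp add: P_def power_sum_def)
    have "E (Suc n) * P (Suc n) = E n * P n * (1 - fps_const (z n) * fps_X)
        + E n * ((1 - fps_const (z n) * fps_X) * Abs_fps (\<lambda>k. z n ^ Suc k))"
      unfolding E P by (simp add: algebra_simps)
    then show ?case
      unfolding geom by (simp add: E Suc algebra_simps)
  qed
  then have "fps_nth (fps_deriv (E n)) k = - fps_nth (E n * P n) k" by simp
  then show ?thesis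
    by (simp add: Suc fps_mult_nth E_def P_def esym_def atLeast0AtMost lessThan_Suc_atMost Suc_diff_le)
qed

lemma esym_0: "esym n z 0 = 1"
  unfolding esym_def by (induction n) simp_all

text \<open>In the difference of the two identities all mixed terms cancel, except the one with the new power
  sum, whose coefficient is \<open>esym n x 0 = 1\<close>.\<close>
lemma newton_difference:
  assumes "\<forall>k\<in>{1..<m}. power_sum n y k = power_sum n x k" "\<forall>k<m. esym n y k = esym n x k" "m > 0"
  shows "real m * (esym n y m - esym n x m) = - (power_sum n y m - power_sum n x m)"
proof -
  have "(\<Sum>i<m. esym n y i * power_sum n y (m - i)) - (\<Sum>i<m. esym n x i * power_sum n x (m - i))
     = (\<Sum>i<m. esym n x i * (power_sum n y (m - i) - power_sum n x (m - i)))"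
    using assms(2) by (simp add: sum_subtractf[symmetric] right_diff_distrib)
  also have "\<dots> = (\<Sum>i\<in>{0}. esym n x i * (power_sum n y (m - i) - power_sum n x (m - i)))"
    using assms(1,3) by (intro sum.mono_neutral_right) auto
  finally show ?thesis
    by (simp add: right_diff_distrib newton_identity esym_0)
qed

lemma esym_eq_iff_power_sum_eq:
  "(\<forall>k\<in>{1..m}. esym n y k = esym n x k) \<longleftrightarrow> (\<forall>k\<in>{1..m}. power_sum n y k = power_sum n x k)"
proof (induction m)
  case (Suc m)
  have "esym n y (Suc m) = esym n x (Suc m) \<longleftrightarrow> power_sum n y (Suc m) = power_sum n x (Suc m)"
    if "\<forall>k\<in>{1..m}. esym n y k = esym n x k"
  proof -
    have "\<forall>k<Suc m. esym n y k = esym n x k" 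
      using that by (auto simp: less_Suc_eq_le) (metis esym_0 not_less_eq_eq One_nat_def Suc_leI atLeastAtMost_iff gr0I)
    moreover have "\<forall>k\<in>{1..<Suc m}. power_sum n y k = power_sum n x k" using Suc that by auto
    ultimately have "real (Suc m) * (esym n y (Suc m) - esym n x (Suc m))
        = - (power_sum n y (Suc m) - power_sum n x (Suc m))"
      using newton_difference[of "Suc m" n y x] by blast
    then have "real (Suc m) * (esym n y (Suc m) - esym n x (Suc m)) = 0 \<longleftrightarrow>
        power_sum n y (Suc m) - power_sum n x (Suc m) = 0"
      by linarith
    then show ?thesis unfolding mult_eq_0_iff by (simp del: of_nat_Suc)
  qed
  then show ?case using Suc by (simp only: atLeastAtMostSuc_conv[of 1 m] ball_simps One_nat_def Suc_le_mono) (auto simp: atLeastAtMostSuc_conv)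
qed simp

lemma roots_poly_in_slice_iff:
  assumes "s \<le> n"
  shows "roots_poly n y \<in> hyperbolic_slice n s (roots_poly n x) \<longleftrightarrow>
    (\<forall>k\<in>{1..s}. power_sum n y k = power_sum n x k)"
  using assms esym_eq_iff_power_sum_eq[of s n y x]
  by (simp add: hyperbolic_slice_def roots_poly_in_hyperbolic_polys coeff_roots_poly)

text \<open>By Newton's identity, a minimal polynomial of a slice is one that maximises the next power sum.\<close>
lemma next_coeff_le_iff:
  assumes "s < n" "\<forall>k\<in>{1..s}. power_sum n y k = power_sum n x k"
  shows "coeff (roots_poly n x) (n - (s + 1)) \<le> coeff (roots_poly n y) (n - (s + 1)) \<longleftrightarrow>
    power_sum n y (s + 1) \<le> power_sum n x (s + 1)"
proof -
  have "\<forall>k<Suc s. esym n y k = esym n x k" 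
    using assms(2) esym_eq_iff_power_sum_eq[of s n y x] 
    by (auto simp: less_Suc_eq_le) (metis esym_0 not_less_eq_eq One_nat_def Suc_leI atLeastAtMost_iff gr0I)
  then have "real (Suc s) * (esym n y (Suc s) - esym n x (Suc s))
        = - (power_sum n y (Suc s) - power_sum n x (Suc s))"
    using newton_difference[of "Suc s" n y x] assms(2) by (simp add: atLeastLessThanSuc_atLeastAtMost)
  moreover have "0 \<le> esym n y (Suc s) - esym n x (Suc s) \<longleftrightarrow>
      0 \<le> real (Suc s) * (esym n y (Suc s) - esym n x (Suc s))"
    by (simp add: zero_le_mult_iff del: of_nat_Suc)
  ultimately have "esym n x (Suc s) \<le> esym n y (Suc s) \<longleftrightarrow> power_sum n y (Suc s) \<le> power_sum n x (Suc s)"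
    by linarith
  then show ?thesis using assms(1) by (simp add: coeff_roots_poly[where k="Suc s"])
qed

section \<open>Lowering a coefficient of a hyperbolic polynomial\<close>

lemma roots_poly_eq_prod_order:
  "roots_poly n z = (\<Prod>t\<in>z ` {..<n}. [:- t, 1:] ^ order t (roots_poly n z))"
proof -
  have "roots_poly n z = (\<Prod>t\<in>z ` {..<n}. \<Prod>i | i \<in> {..<n} \<and> z i = t. [:- z i, 1:])"
    unfolding roots_poly_def by (rule prod.image_gen) simp
  also have "\<dots> = (\<Prod>t\<in>z ` {..<n}. \<Prod>i | i < n \<and> z i = t. [:- t, 1:])"
    by (intro prod.cong) auto
  finally show ?thesis unfolding order_roots_poly prod_constant .
qed

lemma hyperbolic_if_card_roots:
  assumes "p \<noteq> 0" "degree p \<le> card {x. poly p x = 0}"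
  shows "hyperbolic p"
  unfolding hyperbolic_def
proof (intro allI impI, rule ccontr)
  fix z :: complex
  assume z: "poly (map_poly of_real p) z = 0" "z \<notin> \<real>"
  define P where "P = (map_poly of_real p :: complex poly)"
  have P: "degree P = degree p" "P \<noteq> 0"
    using assms(1) by (auto simp: P_def degree_map_poly map_poly_eq_0_iff)
  have "insert z (of_real ` {x. poly p x = 0}) \<subseteq> {z. poly P z = 0}"
    using z by (auto simp: P_def poly_map_of_real)
  then have "card (insert z (of_real ` {x. poly p x = 0})) \<le> card {z. poly P z = 0}"
    using poly_roots_finite[OF P(2)] by (intro card_mono)
  also have "\<dots> \<le> degree p" using card_poly_roots_bound[OF P(2)] P(1) by simp
  also have "card (insert z (of_real ` {x. poly p x = 0})) = Suc (card {x. poly p x = 0})"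
    using z(2) poly_roots_finite[OF assms(1)]
    by (subst card_insert_disjoint) (auto simp: card_image inj_on_def)
  finally show False using assms(2) by simp
qed

text \<open>The sign of a product of differences is given by the number of negative factors. The family is indexed
  because its values may coincide.\<close>
lemma prod_diff_pos_iff:
  fixes t :: real
  assumes "finite I" "\<forall>i\<in>I. c i \<noteq> t"
  shows "(\<Prod>i\<in>I. t - c i) > 0 \<longleftrightarrow> even (card {i \<in> I. t < c i})"
proof -
  have "(\<Prod>i\<in>I. t - c i) = (- 1) ^ card {i \<in> I. t < c i} * (\<Prod>i\<in>I. \<bar>t - c i\<bar>)"
    using assms(1)
  proof (induction I rule: finite_induct)
    case (insert i I)
    have "{j \<in> insert i I. t < c j} =
        (if t < c i then insert i {j \<in> I. t < c j} else {j \<in> I. t < c j})" by auto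
    then have "card {j \<in> insert i I. t < c j} = (if t < c i then 1 else 0) + card {j \<in> I. t < c j}"
      using insert.hyps by auto
    moreover have "t - c i = (- 1) ^ (if t < c i then 1 else 0) * \<bar>t - c i\<bar>" by simp
    ultimately show ?case using insert by (simp add: power_add mult_ac)
  qed simp
  moreover have "(\<Prod>i\<in>I. \<bar>t - c i\<bar>) > 0" using assms by (intro prod_pos) auto
  ultimately show ?thesis by (cases "even (card {i \<in> I. t < c i})") auto
qed

lemma exists_top_subset:
  fixes J :: "real set"
  assumes "finite J" "r \<le> card J"
  shows "\<exists>J'\<subseteq>J. card J' = r \<and> (\<forall>j\<in>J'. \<forall>i\<in>J - J'. i < j)"
  using assms
proof (induction J rule: finite_linorder_min_induct)
  case (insert b J)
  show ?case
  proof (cases "r \<le> card J")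
    case True
    then obtain J' where "J' \<subseteq> J" "card J' = r" "\<forall>j\<in>J'. \<forall>i\<in>J - J'. i < j"
      using insert.IH by blast
    then show ?thesis using insert.hyps by (intro exI[of _ J']) auto
  next
    case False
    have "b \<notin> J" using insert.hyps by blast
    then have "r = card (insert b J)" using False insert by simp
    then show ?thesis by (intro exI[of _ "insert b J"]) auto
  qed
qed simp

text \<open>Think of \<open>A\<close> as the roots of a polynomial and of \<open>S\<close> as the simple ones; the double roots of a
  divisor \<open>U\<close> will be taken from \<open>J\<close>. Walking through \<open>A\<close> from the top, a multiple root is put into \<open>J\<close> whenever the
  number of roots left out so far is even. A multiple root is thus left out only if an odd number was
  left out before, and then the last one left out was simple; pairing the two bounds the size of \<open>A - J\<close>.\<close>
lemma exists_even_above_subset: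
  fixes A S :: "real set"
  assumes "finite A" "S \<subseteq> A"
  shows "\<exists>J\<subseteq>A - S. card (A - J) \<le> 2 * card S \<and> (\<forall>j\<in>J. even (card {a \<in> A - J. j < a}))"
  using assms
proof (induction A arbitrary: S rule: finite_linorder_min_induct)
  case (insert b A)
  have b: "b \<notin> A" using insert.hyps by blast
  obtain J where J: "J \<subseteq> A - (S - {b})" "card (A - J) \<le> 2 * card (S - {b})"
    "\<forall>j\<in>J. even (card {a \<in> A - J. j < a})"
    using insert.IH[of "S - {b}"] insert.prems by blast
  have fin: "finite S" using insert.prems insert.hyps(1) finite_subset by blast
  have above: "{a \<in> insert b A - J. j < a} = {a \<in> A - J. j < a}" if "j \<in> J" for j
    using insert.hyps that J(1) by force
  have diff: "insert b A - J = insert b (A - J)" using b J(1) by auto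
  have cd: "card (insert b A - J) = Suc (card (A - J))"
    unfolding diff using b insert.hyps(1) by simp
  consider "b \<in> S" | "b \<notin> S" "odd (card (A - J))" | "b \<notin> S" "even (card (A - J))" by blast
  then show ?case
  proof cases
    case 1
    then have "card S = Suc (card (S - {b}))" using fin by (metis card.remove)
    then show ?thesis using J above cd 1 b by (intro exI[of _ J]) auto
  next
    case 2
    then have "S - {b} = S" by simp
    moreover have "card (A - J) \<noteq> 2 * card S" using 2(2) by auto
    ultimately show ?thesis using J above cd 2 by (intro exI[of _ J]) auto
  next
    case 3
    then have S: "S - {b} = S" by simp
    have eq: "insert b A - insert b J = A - J" using b by auto
    have "{a \<in> A - J. b < a} = A - J" using insert.hyps by auto
    then have "\<forall>j\<in>insert b J. even (card {a \<in> A - J. j < a})" using 3 J by auto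
    moreover have "insert b J \<subseteq> insert b A - S" using J(1) 3(1) S by blast
    moreover have "card (insert b A - insert b J) \<le> 2 * card S" using J(2) S eq by simp
    ultimately show ?thesis unfolding eq[symmetric] by blast
  qed
qed simp

lemma exists_separation:
  fixes A :: "real set"
  assumes "finite A"
  shows "\<exists>\<eta>>0. \<forall>a\<in>A. \<forall>b\<in>A. a \<noteq> b \<longrightarrow> 2 * \<eta> \<le> \<bar>a - b\<bar>"
proof -
  define D where "D = insert 1 ((\<lambda>(a, b). \<bar>a - b\<bar>) ` {(a, b) \<in> A \<times> A. a \<noteq> b})"
  have fin: "finite D" unfolding D_def
    by (intro finite.insertI finite_imageI finite_subset[of "{(a, b) \<in> A \<times> A. a \<noteq> b}" "A \<times> A"])
       (use assms in auto)
  then have "Min D > 0" by (subst Min_gr_iff) (auto simp: D_def)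
  moreover have "Min D \<le> \<bar>a - b\<bar>" if "a \<in> A" "b \<in> A" "a \<noteq> b" for a b
    using fin that by (intro Min_le) (auto simp: D_def)
  ultimately show ?thesis by (intro exI[of _ "Min D / 2"]) auto
qed

text \<open>The function changes sign at a simple root, so it is positive on one of the two sides.\<close>
lemma poly_pos_near_simple_root:
  fixes R :: "real poly"
  assumes "\<And>t. u t = (t - a) * poly R t" "poly R a \<noteq> 0" "\<eta> > 0"
  shows "\<exists>t. \<bar>t - a\<bar> < \<eta> \<and> u t > 0"
proof -
  have "((\<lambda>t. poly R t * sgn (poly R a)) \<longlongrightarrow> poly R a * sgn (poly R a)) (at a)"
    by (intro tendsto_intros)
  moreover have "poly R a * sgn (poly R a) > 0" using assms(2) by (simp add: sgn_if)
  ultimately have "eventually (\<lambda>t. poly R t * sgn (poly R a) > 0) (at a)"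
    by (metis order_tendstoD(1))
  then obtain d where d: "d > 0" "\<And>t. t \<noteq> a \<Longrightarrow> dist t a < d \<Longrightarrow> poly R t * sgn (poly R a) > 0"
    by (auto simp: eventually_at)
  define h where "h = min d \<eta> / 2"
  have h: "h > 0" "h < d" "h < \<eta>" using d(1) assms(3) by (auto simp: h_def)
  define t where "t = a + sgn (poly R a) * h"
  have "t \<noteq> a" "\<bar>t - a\<bar> = h" using h assms(2) by (auto simp: t_def abs_mult abs_sgn_eq sgn_if)
  then have "poly R t * sgn (poly R a) > 0" "\<bar>t - a\<bar> < \<eta>"
    using d(2)[of t] h by (auto simp: dist_real_def)
  moreover have "u t = h * (poly R t * sgn (poly R a))" by (simp add: assms(1) t_def)
  ultimately show ?thesis using h(1) by (intro exI[of _ t]) simp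
qed

lemma poly_pos_near_double_root:
  fixes R :: "real poly"
  assumes "\<And>t. u t = (t - a)\<^sup>2 * poly R t" "poly R a > 0" "\<eta> > 0"
  shows "\<exists>t1 t2. a - \<eta> < t1 \<and> t1 < a \<and> a < t2 \<and> t2 < a + \<eta> \<and> u t1 > 0 \<and> u t2 > 0"
proof -
  have "((\<lambda>t. poly R t) \<longlongrightarrow> poly R a) (at a)" by (intro tendsto_intros)
  with assms(2) have "eventually (\<lambda>t. poly R t > 0) (at a)"
    by (metis order_tendstoD(1))
  then obtain d where d: "d > 0" "\<And>t. t \<noteq> a \<Longrightarrow> dist t a < d \<Longrightarrow> poly R t > 0"
    by (auto simp: eventually_at)
  define h where "h = min d \<eta> / 2"
  have h: "h > 0" "h < d" "h < \<eta>" using d(1) assms(3) by (auto simp: h_def)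
  have "poly R (a - h) > 0" "poly R (a + h) > 0" using d(2) h by (auto simp: dist_real_def)
  then have "u (a - h) > 0" "u (a + h) > 0" using h by (auto simp: assms(1))
  then show ?thesis using h by (intro exI[of _ "a - h"] exI[of _ "a + h"]) auto
qed

text \<open>By \<open>prod_diff_pos_iff\<close> the parity condition makes \<open>U\<close> positive on both sides of each double root.
  Lowering the graph of \<open>U\<close> slightly then splits each double root into two real roots and moves each
  simple root a little. In total there are as many distinct real roots as the degree.\<close>
lemma hyperbolic_minus_small_constant:
  fixes A J :: "real set"
  assumes A: "finite A" "A \<noteq> {}" and J: "J \<subseteq> A"
    and even: "\<forall>j\<in>J. even (card {a \<in> A - J. j < a})"
  defines "U \<equiv> (\<Prod>a\<in>A. [:- a, 1:]) * (\<Prod>a\<in>J. [:- a, 1:])"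
  shows "\<exists>\<epsilon>>0. hyperbolic (U - [:\<epsilon>:])"
proof -
  have fin: "finite J" using A J finite_subset by blast
  obtain \<eta> where \<eta>: "\<eta> > 0" "\<And>a b. a \<in> A \<Longrightarrow> b \<in> A \<Longrightarrow> a \<noteq> b \<Longrightarrow> 2 * \<eta> \<le> \<bar>a - b\<bar>"
    using exists_separation[OF A(1)] by blast
  have U_eval: "poly U t = (\<Prod>a\<in>A. t - a) * (\<Prod>a\<in>J. t - a)" for t
    by (simp add: U_def poly_prod)
  have U0: "poly U a = 0" if "a \<in> A" for a
    using that A(1) by (auto simp: U_eval)
  have "\<exists>t1 t2. \<bar>t1 - a\<bar> < \<eta> \<and> \<bar>t2 - a\<bar> < \<eta> \<and> poly U t1 > 0 \<and> poly U t2 > 0 \<and>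
      (a \<in> J \<longrightarrow> t1 < a \<and> a < t2)" if a: "a \<in> A" for a
  proof (cases "a \<in> J")
    case False
    define R where "R = (\<Prod>b\<in>A - {a}. [:- b, 1:]) * (\<Prod>b\<in>J. [:- b, 1:])"
    have "poly U t = (t - a) * poly R t" for t
      using a A(1) by (simp add: U_eval R_def poly_prod prod.remove)
    moreover have "poly R a \<noteq> 0" using False A(1) fin by (auto simp: R_def poly_prod)
    ultimately obtain t where "\<bar>t - a\<bar> < \<eta>" "poly U t > 0"
      using poly_pos_near_simple_root[of "poly U" a R \<eta>] \<eta>(1) by blast
    then show ?thesis using False by blast
  next
    case True
    define R where "R = (\<Prod>b\<in>A - {a}. [:- b, 1:]) * (\<Prod>b\<in>J - {a}. [:- b, 1:])"
    have "poly U t = (t - a)\<^sup>2 * poly R t" for t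
      using a True A(1) fin
      by (simp add: U_eval R_def poly_prod prod.remove[of A a] prod.remove[of J a] power2_eq_square)
    moreover have "poly R a > 0"
    proof -
      have "A - {a} = (A - J) \<union> (J - {a})" using J True by auto
      then have "(\<Prod>b\<in>A - {a}. a - b) = (\<Prod>b\<in>A - J. a - b) * (\<Prod>b\<in>J - {a}. a - b)"
        using A(1) fin by (simp only:) (rule prod.union_disjoint, auto)
      then have "poly R a = (\<Prod>b\<in>A - J. a - b) * (\<Prod>b\<in>J - {a}. a - b)\<^sup>2"
        by (simp add: R_def poly_prod power2_eq_square)
      moreover have "(\<Prod>b\<in>A - J. a - b) > 0"
        using even True A(1) by (subst prod_diff_pos_iff) auto
      moreover have "(\<Prod>b\<in>J - {a}. a - b) \<noteq> 0" using fin by auto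
      ultimately show ?thesis by simp
    qed
    ultimately obtain t1 t2 where "a - \<eta> < t1" "t1 < a" "a < t2" "t2 < a + \<eta>" "poly U t1 > 0" "poly U t2 > 0"
      using poly_pos_near_double_root[of "poly U" a R \<eta>] \<eta>(1) by blast
    then show ?thesis by (intro exI[of _ t1] exI[of _ t2]) auto
  qed
  then obtain t1 t2 where t: "\<And>a. a \<in> A \<Longrightarrow> \<bar>t1 a - a\<bar> < \<eta> \<and> \<bar>t2 a - a\<bar> < \<eta> \<and>
      poly U (t1 a) > 0 \<and> poly U (t2 a) > 0 \<and> (a \<in> J \<longrightarrow> t1 a < a \<and> a < t2 a)" by metis
  define V where "V = (\<lambda>a. poly U (t1 a)) ` A \<union> (\<lambda>a. poly U (t2 a)) ` A"
  have V: "finite V" "V \<noteq> {}" using A by (auto simp: V_def)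
  define \<epsilon> where "\<epsilon> = Min V / 2"
  have "Min V > 0" using V t by (subst Min_gr_iff) (auto simp: V_def)
  then have \<epsilon>: "\<epsilon> > 0" "\<epsilon> < Min V" by (auto simp: \<epsilon>_def)
  have less: "\<epsilon> < poly U (t1 a)" "\<epsilon> < poly U (t2 a)" if "a \<in> A" for a
  proof -
    have "Min V \<le> poly U (t1 a)" "Min V \<le> poly U (t2 a)"
      using that V by (auto intro!: Min_le simp: V_def)
    then show "\<epsilon> < poly U (t1 a)" "\<epsilon> < poly U (t2 a)" using \<epsilon> by auto
  qed
  \<comment> \<open>The graph of U passes the level \<open>\<epsilon>\<close> between a root, where U vanishes, and a nearby point above the level.\<close>
  have between: "\<exists>r. poly U r = \<epsilon> \<and> \<bar>r - a\<bar> < \<eta> \<and> (t < a \<longrightarrow> r < a) \<and> (a < t \<longrightarrow> a < r)"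
    if "a \<in> A" "\<bar>t - a\<bar> < \<eta>" "\<epsilon> < poly U t" for a t
  proof -
    have "isCont (\<lambda>x. poly U x) x" for x by (intro continuous_intros)
    moreover have "poly U a \<le> \<epsilon>" "\<epsilon> \<le> poly U t" "poly U a \<noteq> \<epsilon>" using U0[OF that(1)] \<epsilon> that by auto
    ultimately have "\<exists>r. (a \<le> r \<and> r \<le> t \<or> t \<le> r \<and> r \<le> a) \<and> poly U r = \<epsilon>"
      using IVT[of "poly U" a \<epsilon> t] IVT2[of "poly U" a \<epsilon> t] by (cases "a \<le> t") auto
    then obtain r where "a \<le> r \<and> r \<le> t \<or> t \<le> r \<and> r \<le> a" "poly U r = \<epsilon>" by blast
    moreover from this have "r \<noteq> a" using \<open>poly U a \<noteq> \<epsilon>\<close> by blast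
    ultimately show ?thesis using that(2) by (intro exI[of _ r]) auto
  qed
  have "\<exists>r. poly U r = \<epsilon> \<and> \<bar>r - a\<bar> < \<eta> \<and> (a \<in> J \<longrightarrow> r < a)" if "a \<in> A" for a
    using between[OF that, of "t1 a"] t[OF that] less[OF that] by blast
  then obtain r1 where r1: "\<And>a. a \<in> A \<Longrightarrow> poly U (r1 a) = \<epsilon> \<and> \<bar>r1 a - a\<bar> < \<eta> \<and> (a \<in> J \<longrightarrow> r1 a < a)"
    by metis
  have "\<exists>r. poly U r = \<epsilon> \<and> \<bar>r - a\<bar> < \<eta> \<and> a < r" if "a \<in> J" for a
    using between[of a "t2 a"] t[of a] less[of a] that J by blast
  then obtain r2 where r2: "\<And>a. a \<in> J \<Longrightarrow> poly U (r2 a) = \<epsilon> \<and> \<bar>r2 a - a\<bar> < \<eta> \<and> a < r2 a"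
    by metis
  have close: "a = b" if "a \<in> A" "b \<in> A" "\<bar>r - a\<bar> < \<eta>" "\<bar>r - b\<bar> < \<eta>" for a b r
    using \<eta>(2)[of a b] that by linarith
  have inj: "inj_on r1 A" "inj_on r2 J"
    using r1 r2 J by (auto intro!: inj_onI close)
  have disj: "r1 ` A \<inter> r2 ` J = {}"
  proof (safe, goal_cases)
    case (1 x a b)
    then have "a = b" using r1[of a] r2[of b] J close[of a b "r1 a"] by auto
    then show ?case using r1[of a] r2[of b] 1 J by force
  qed
  let ?p = "U - [:\<epsilon>:]"
  obtain a where "a \<in> A" using A(2) by blast
  then have p0: "?p \<noteq> 0" using U0[of a] \<epsilon>(1) by (metis less_irrefl eq_iff_diff_eq_0 poly_const_conv)
  have "degree U = card A + card J"
    unfolding U_def by (subst degree_mult_eq) (auto simp: degree_prod_eq_sum_degree A(1) fin)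
  then have "degree ?p \<le> card A + card J" by (intro degree_diff_le) auto
  also have "\<dots> = card (r1 ` A \<union> r2 ` J)"
    using disj inj A(1) fin by (simp add: card_Un_disjoint card_image)
  also have "\<dots> \<le> card {x. poly ?p x = 0}"
    using r1 r2 poly_roots_finite[OF p0] by (intro card_mono) auto
  finally have "hyperbolic ?p" by (rule hyperbolic_if_card_roots[OF p0])
  then show ?thesis using \<epsilon>(1) by blast
qed

text \<open>If \<open>G\<close> has more than \<open>s\<close> distinct roots, then \<open>s + 1\<close> of them are the simple roots of \<open>U\<close>, and \<open>U\<close>
  has no double roots. Otherwise \<open>U\<close> uses all roots of \<open>G\<close>, and \<open>s + 1 - card R\<close> of the multiple ones
  twice; if the second inequality fails, the greedy choice of \<open>exists_even_above_subset\<close> offers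
  enough of them.\<close>
lemma minimal_in_slice_card_roots:
  assumes min: "minimal_in_slice n s F G" and s: "s < n"
  defines "R \<equiv> {x. poly G x = 0}"
  defines "S \<equiv> {x \<in> R. order x G = 1}"
  shows "card R \<le> s \<and> 2 * card R \<le> s + 2 * card S"
proof (rule ccontr)
  assume contr: "\<not> (card R \<le> s \<and> 2 * card R \<le> s + 2 * card S)"
  have G: "G \<in> hyperbolic_slice n s F" using min by (simp add: minimal_in_slice_def)
  then have G_hyp: "G \<in> hyperbolic_polys n" by (simp add: hyperbolic_slice_def)
  have deg: "degree G = n" using G_hyp by (simp add: hyperbolic_polys_def)
  have G0: "G \<noteq> 0" using deg s by auto
  have fin: "finite R" unfolding R_def by (rule poly_roots_finite[OF G0])
  have "\<exists>A J. A \<subseteq> R \<and> J \<subseteq> A - S \<and> card A + card J = s + 1 \<and> (\<forall>j\<in>J. even (card {a \<in> A - J. j < a}))"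
  proof (cases "card R \<le> s")
    case False
    then obtain A where "A \<subseteq> R" "card A = s + 1"
      by (metis obtain_subset_with_card_n not_less_eq_eq Suc_eq_plus1)
    then show ?thesis by (intro exI[of _ A] exI[of _ "{}"]) auto
  next
    case True
    obtain J where J: "J \<subseteq> R - S" "card (R - J) \<le> 2 * card S"
      "\<forall>j\<in>J. even (card {a \<in> R - J. j < a})"
      using exists_even_above_subset[OF fin, of S] by (auto simp: S_def)
    have finJ: "finite J" using J(1) fin by (meson finite_Diff finite_subset)
    have "card (R - J) = card R - card J" using J(1) finJ by (intro card_Diff_subset) auto
    then have "s + 1 - card R \<le> card J" using J(2) contr True by linarith
    then obtain J' where J': "J' \<subseteq> J" "card J' = s + 1 - card R" "\<forall>j\<in>J'. \<forall>i\<in>J - J'. i < j"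
      using exists_top_subset[OF finJ] by blast
    \<comment> \<open>Dropping the smallest elements of J does not change what lies above the remaining ones.\<close>
    have "{a \<in> R - J'. j < a} = {a \<in> R - J. j < a}" if "j \<in> J'" for j
    proof -
      have "\<not> j < a" if "a \<in> J" "a \<notin> J'" for a
        using J'(3) that \<open>j \<in> J'\<close> by (meson DiffI less_asym)
      then show ?thesis using J'(1) by blast
    qed
    moreover have "even (card {a \<in> R - J. j < a})" if "j \<in> J'" for j
      using J(3) J'(1) that by blast
    ultimately have "\<forall>j\<in>J'. even (card {a \<in> R - J'. j < a})" by simp
    moreover have "J' \<subseteq> R - S" using J(1) J'(1) by blast
    moreover have "card R + card J' = s + 1" using J'(2) True by linarith
    ultimately show ?thesis by blast
  qed
  then obtain A J where A: "A \<subseteq> R" "J \<subseteq> A - S" "card A + card J = s + 1"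
    "\<forall>j\<in>J. even (card {a \<in> A - J. j < a})" by blast
  have finA: "finite A" "finite J" using A fin by (meson finite_subset finite_Diff)+
  have "A \<noteq> {}" using A by auto
  define U where "U = (\<Prod>a\<in>A. [:- a, 1:]) * (\<Prod>a\<in>J. [:- a, 1:])"
  obtain \<epsilon> where \<epsilon>: "\<epsilon> > 0" "hyperbolic (U - [:\<epsilon>:])"
    unfolding U_def using hyperbolic_minus_small_constant[OF finA(1) \<open>A \<noteq> {}\<close> _ A(4)] A(2) by blast
  have degU: "degree U = s + 1"
    unfolding U_def A(3)[symmetric]
    by (subst degree_mult_eq) (auto simp: degree_prod_eq_sum_degree finA)
  have leadU: "lead_coeff U = 1" unfolding U_def lead_coeff_mult by (simp add: lead_coeff_prod)
  have "U dvd G"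
  proof -
    have ord: "1 \<le> order x G" if "x \<in> R" for x
      using that G0 order_root[of G x] by (simp add: R_def Suc_le_eq)
    have ord2: "2 \<le> order x G" if "x \<in> J" for x
      using ord[of x] that A unfolding S_def by (force simp: numeral_2_eq_2)
    have "(\<Prod>a\<in>J. [:- a, 1:]) = (\<Prod>a\<in>A. [:- a, 1:] ^ (if a \<in> J then 1 else 0))"
      using A(2) finA by (intro prod.mono_neutral_cong_left) auto
    then have "U = (\<Prod>a\<in>A. [:- a, 1:] ^ (if a \<in> J then 2 else 1))"
      unfolding U_def by (simp only: prod.distrib[symmetric])
         (intro prod.cong, auto simp: power2_eq_square)
    also have "\<dots> dvd (\<Prod>a\<in>R. [:- a, 1:] ^ order a G)"
      using A fin ord ord2 by (intro prod_dvd_prod_subset2 le_imp_power_dvd) auto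
    also have "\<dots> = G"
      using hyperbolic_polys_split[OF G_hyp] roots_poly_eq_prod_order roots_poly_zeros
      unfolding R_def by metis
    finally show ?thesis .
  qed
  then obtain W where W: "G = U * W" by (rule dvdE)
  have W0: "W \<noteq> 0" and U0: "U \<noteq> 0" using G0 unfolding W by auto
  have degG: "degree G = n" "lead_coeff G = 1" "hyperbolic G" using G_hyp by (auto simp: hyperbolic_polys_def)
  have degW: "degree W = n - (s + 1)"
    using degG(1) degU degree_mult_eq[OF U0 W0] unfolding W by simp
  have leadW: "lead_coeff W = 1" using degG(2) leadU unfolding W lead_coeff_mult by simp
  have hypW: "hyperbolic W" using degG(3) hyperbolic_factor[of W U] unfolding W by (simp only: mult.commute)
  define H where "H = (U - [:\<epsilon>:]) * W"
  have H_eq: "H = G - smult \<epsilon> W" by (simp add: H_def W left_diff_distrib)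
  have coeff_H: "coeff H k = coeff G k" if "k > n - (s + 1)" for k
    using that degW by (simp add: H_eq coeff_eq_0)
  have lead_H: "coeff H (n - (s + 1)) = coeff G (n - (s + 1)) - \<epsilon>"
    using leadW degW by (simp add: H_eq)
  have "degree H \<le> n" unfolding H_eq using degG(1) degW degree_smult_le[of \<epsilon> W]
    by (intro degree_diff_le) auto
  moreover have "coeff H n = 1" using coeff_H[of n] s degG by simp
  ultimately have "degree H = n" by (metis le_antisym le_degree zero_neq_one)
  then have "H \<in> hyperbolic_polys n"
    using \<open>coeff H n = 1\<close> hyperbolic_mult[OF \<epsilon>(2) hypW] by (simp add: hyperbolic_polys_def H_def)
  moreover have "coeff H (n - i) = coeff F (n - i)" if "i \<in> {1..s}" for i
    using that s coeff_H[of "n - i"] G by (auto simp: hyperbolic_slice_def)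
  ultimately have "H \<in> hyperbolic_slice n s F" by (simp add: hyperbolic_slice_def)
  then have "coeff G (n - (s + 1)) \<le> coeff H (n - (s + 1))"
    using min s by (auto simp: minimal_in_slice_def)
  then show False using lead_H \<epsilon>(1) by simp
qed

section \<open>Comparing sorted root sequences with equal power sums\<close>

lemma poly_strict_increase:
  fixes F :: "real poly"
  assumes "a < b" "\<And>t. a < t \<Longrightarrow> t < b \<Longrightarrow> poly (pderiv F) t \<ge> 0" "pderiv F \<noteq> 0"
  shows "poly F a < poly F b"
proof -
  have le: "poly F u \<le> poly F v" if "a \<le> u" "u \<le> v" "v \<le> b" for u v
  proof (cases "u = v")
    case False
    then have "u < v" using that by simp
    then obtain t where "u < t" "t < v" "poly F v - poly F u = (v - u) * poly (pderiv F) t"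
      using poly_MVT by blast
    moreover from this have "poly (pderiv F) t \<ge> 0" using assms(2) that by simp
    moreover from this have "0 \<le> (v - u) * poly (pderiv F) t"
      using \<open>u < v\<close> by (intro mult_nonneg_nonneg) auto
    ultimately show ?thesis by linarith
  qed simp
  have "poly F a \<noteq> poly F b"
  proof
    assume eq: "poly F a = poly F b"
    have "{a..b} \<subseteq> {t. poly (F - [:poly F a:]) t = 0}"
    proof
      fix t assume "t \<in> {a..b}"
      then have "poly F t = poly F a" using le[of a t] le[of t b] eq by simp
      then show "t \<in> {t. poly (F - [:poly F a:]) t = 0}" by simp
    qed
    then have "\<not> finite {t. poly (F - [:poly F a:]) t = 0}"
      by (rule infinite_super) (rule infinite_Icc[OF assms(1)])
    then have "F - [:poly F a:] = 0" using poly_roots_finite by blast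
    then have "F = [:poly F a:]" by simp
    then have "pderiv F = 0" by (metis pderiv_singleton)
    then show False using assms(3) by simp
  qed
  then show ?thesis using le[of a b] assms(1) by simp
qed

lemma weighted_increments_pos:
  fixes F :: "real poly" and w x y :: "'i \<Rightarrow> real"
  assumes "finite I" "\<And>i. i \<in> I \<Longrightarrow> w i > 0" "pderiv F \<noteq> 0"
    and sign: "\<And>i t. i \<in> I \<Longrightarrow> x i < t \<and> t < y i \<Longrightarrow> poly (pderiv F) t \<ge> 0"
      "\<And>i t. i \<in> I \<Longrightarrow> y i < t \<and> t < x i \<Longrightarrow> poly (pderiv F) t \<le> 0"
    and ne: "\<exists>i\<in>I. x i \<noteq> y i"
  shows "(\<Sum>i\<in>I. w i * (poly F (y i) - poly F (x i))) > 0"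
proof -
  have less: "poly F (x i) < poly F (y i)" if "i \<in> I" "x i \<noteq> y i" for i
  proof (cases "x i < y i")
    case True
    then show ?thesis using sign(1)[OF that(1)] assms(3) by (intro poly_strict_increase) auto
  next
    case False
    then have "poly (- F) (y i) < poly (- F) (x i)"
      using sign(2)[OF that(1)] assms(3) that(2) by (intro poly_strict_increase) (auto simp: pderiv_minus)
    then show ?thesis by simp
  qed
  have "w i * (poly F (y i) - poly F (x i)) \<ge> 0" if "i \<in> I" for i
    using assms(2)[OF that] less[OF that] by (cases "x i = y i") auto
  moreover obtain i where "i \<in> I" "x i \<noteq> y i" using ne by blast
  moreover from this have "w i * (poly F (y i) - poly F (x i)) > 0" using less assms(2) by simp
  ultimately show ?thesis using assms(1) by (meson sum_pos2)
qed

lemma poly_antiderivative: "\<exists>F::real poly. pderiv F = q"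
proof -
  define F where "F = (\<Sum>k\<le>degree q. monom (coeff q k / real (Suc k)) (Suc k))"
  have "coeff (pderiv F) k = coeff q k" for k
  proof -
    have "coeff F (Suc k) = (\<Sum>j\<le>degree q. if j = k then coeff q j / real (Suc j) else 0)"
      unfolding F_def coeff_sum by (intro sum.cong) auto
    then show ?thesis by (auto simp: coeff_pderiv coeff_eq_0)
  qed
  then show ?thesis by (intro exI[of _ F] poly_eqI)
qed

text \<open>The left-hand side is a combination of differences of power sums, so it is known as soon as those are.
  This turns the positivity of \<open>weighted_increments_pos\<close> into statements about power sums.\<close>
lemma weighted_increments_eq:
  fixes F :: "real poly"
  assumes "degree F \<le> d"
  shows "(\<Sum>i\<in>I. w i * (poly F (y i) - poly F (x i))) =
    (\<Sum>k\<le>d. coeff F k * ((\<Sum>i\<in>I. w i * y i ^ k) - (\<Sum>i\<in>I. w i * x i ^ k)))"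
proof -
  have F: "poly F t = (\<Sum>k\<le>d. coeff F k * t ^ k)" for t
    unfolding poly_altdef using assms by (intro sum.mono_neutral_left) (auto simp: coeff_eq_0)
  have "(\<Sum>i\<in>I. w i * (poly F (y i) - poly F (x i))) =
    (\<Sum>i\<in>I. \<Sum>k\<le>d. coeff F k * (w i * y i ^ k - w i * x i ^ k))"
    by (intro sum.cong refl) (simp add: F sum_distrib_left
        sum_subtractf[symmetric] algebra_simps)
  also have "\<dots> = (\<Sum>k\<le>d. \<Sum>i\<in>I. coeff F k * (w i * y i ^ k - w i * x i ^ k))"
    by (rule sum.swap)
  finally show ?thesis by (simp add: sum_distrib_left[symmetric] sum_subtractf)
qed

lemma degree_le_Suc_degree_pderiv:
  fixes F :: "real poly" shows "degree F \<le> Suc (degree (pderiv F))"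
  by (simp add: degree_pderiv)

lemma even_card_sign_changes:
  fixes b :: "nat \<Rightarrow> bool"
  assumes "i \<le> m"
  shows "(b i = b m) \<longleftrightarrow> even (card {j. i \<le> j \<and> j < m \<and> b j \<noteq> b (Suc j)})"
  using assms
proof (induction i rule: inc_induct)
  case (step i)
  have "{j. i \<le> j \<and> j < m \<and> b j \<noteq> b (Suc j)} =
      (if b i \<noteq> b (Suc i) then {i} else {}) \<union> {j. Suc i \<le> j \<and> j < m \<and> b j \<noteq> b (Suc j)}"
    using step.hyps by (auto simp: Suc_le_eq le_less)
  moreover have "finite {j. Suc i \<le> j \<and> j < m \<and> b j \<noteq> b (Suc j)}"
    by (rule finite_subset[of _ "{..<m}"]) auto
  ultimately show ?case using step.IH by auto
next
  case base
  have empty: "{j. m \<le> j \<and> j < m \<and> b j \<noteq> b (Suc j)} = {}" by auto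
  show ?case unfolding empty by simp
qed

text \<open>If the sequences differ, put a root of \<open>q\<close> at each place where the sign of \<open>y\<^sub>i - x\<^sub>i\<close> changes. Such a
  place must be a jump of one of the sequences, hence \<open>q\<close> has degree less than \<open>m\<close>. With the
  right choice of sign, an antiderivative of \<open>q\<close> grows on every step from \<open>x\<^sub>i\<close> to \<open>y\<^sub>i\<close>, although its
  weighted sums over both sequences agree.\<close>
lemma sorted_determined_by_power_sums:
  fixes x y w :: "nat \<Rightarrow> real"
  assumes x: "mono_on {..<N} x" and y: "mono_on {..<N} y"
    and w: "\<And>i. i < N \<Longrightarrow> w i > 0"
    and card: "card {i. Suc i < N \<and> (x i \<noteq> x (Suc i) \<or> y i \<noteq> y (Suc i))} < m"
    and eq: "\<And>k. k \<in> {1..m} \<Longrightarrow> (\<Sum>i<N. w i * y i ^ k) = (\<Sum>i<N. w i * x i ^ k)"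
  shows "\<forall>i<N. x i = y i"
proof (rule ccontr)
  assume "\<not> (\<forall>i<N. x i = y i)"
  then have ne: "\<exists>i\<in>{..<N}. x i \<noteq> y i" by auto
  define b where "b i = (x i \<le> y i)" for i
  define V where "V = {i. Suc i < N \<and> b i \<noteq> b (Suc i)}"
  define c where "c i = max (x i) (y i)" for i
  define \<sigma> :: real where "\<sigma> = (if b (N - 1) then 1 else - 1)"
  define q where "q = smult \<sigma> (\<Prod>i\<in>V. [:- c i, 1:])"
  have finV: "finite V" by (rule finite_subset[of _ "{..<N}"]) (auto simp: V_def)
  have "card V \<le> card {i. Suc i < N \<and> (x i \<noteq> x (Suc i) \<or> y i \<noteq> y (Suc i))}"
  proof (rule card_mono)
    show "finite {i. Suc i < N \<and> (x i \<noteq> x (Suc i) \<or> y i \<noteq> y (Suc i))}"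
      by (rule finite_subset[of _ "{..<N}"]) auto
  qed (auto simp: V_def b_def)
  then have "degree q < m" using card degree_smult_le[of \<sigma> "\<Prod>i\<in>V. [:- c i, 1:]"]
    by (simp add: q_def degree_prod_eq_sum_degree)
  obtain F where F: "pderiv F = q" using poly_antiderivative by blast
  have degF: "degree F \<le> m" using degree_le_Suc_degree_pderiv[of F] \<open>degree q < m\<close> F by simp
  have q0: "q \<noteq> 0" using finV by (auto simp: q_def \<sigma>_def)
  have mono: "x i \<le> x j" "y i \<le> y j" if "i \<le> j" "j < N" for i j
    using x y that by (auto simp: monotone_on_def)
  \<comment> \<open>At a change of sign the intervals spanned by consecutive pairs are separated by c i.\<close>
  have c_le: "c i \<le> x (Suc i)" "c i \<le> y (Suc i)" if "i \<in> V" for i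
    using that mono[of i "Suc i"] by (auto simp: c_def V_def b_def)
  have sign: "b i \<longrightarrow> poly q t \<ge> 0" "\<not> b i \<longrightarrow> poly q t \<le> 0"
    if i: "i < N" and t: "min (x i) (y i) < t" "t < max (x i) (y i)" for i t
  proof -
    have "(b i \<longrightarrow> poly q t \<ge> 0) \<and> (\<not> b i \<longrightarrow> poly q t \<le> 0)"
    proof (cases "\<exists>j\<in>V. c j = t")
      case True
      then have "poly q t = 0" using finV by (auto simp: q_def poly_prod)
      then show ?thesis by simp
    next
      case False
      have "t < c j \<longleftrightarrow> i \<le> j" if "j \<in> V" for j
      proof (cases "i \<le> j")
        case True
        then show ?thesis using t(2) mono[of i j] that by (auto simp: c_def V_def)
      next
        case False
        then show ?thesis using t(1) mono[of "Suc j" i] c_le[OF that] i by auto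
      qed
      then have "{j \<in> V. t < c j} = {j. i \<le> j \<and> j < N - 1 \<and> b j \<noteq> b (Suc j)}"
        by (auto simp: V_def)
      then have "(\<Prod>j\<in>V. t - c j) > 0 \<longleftrightarrow> b i = b (N - 1)"
        using prod_diff_pos_iff[OF finV, of c t] False even_card_sign_changes[of i "N - 1" b] i
        by auto
      moreover have "poly q t = \<sigma> * (\<Prod>j\<in>V. t - c j)" by (simp add: q_def poly_prod)
      ultimately show ?thesis by (auto simp: \<sigma>_def not_less)
    qed
    then show "b i \<longrightarrow> poly q t \<ge> 0" "\<not> b i \<longrightarrow> poly q t \<le> 0" by auto
  qed
  have "0 < (\<Sum>i<N. w i * (poly F (y i) - poly F (x i)))"
  proof (rule weighted_increments_pos)
    show "poly (pderiv F) t \<ge> 0" if "i \<in> {..<N}" "x i < t \<and> t < y i" for i t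
      using sign(1)[of i t] that by (auto simp: F b_def)
    show "poly (pderiv F) t \<le> 0" if "i \<in> {..<N}" "y i < t \<and> t < x i" for i t
      using sign(2)[of i t] that by (auto simp: F b_def)
  qed (use w q0 F ne in auto)
  also have "\<dots> = (\<Sum>k\<le>m. coeff F k * ((\<Sum>i<N. w i * y i ^ k) - (\<Sum>i<N. w i * x i ^ k)))"
    by (rule weighted_increments_eq[OF degF])
  also have "\<dots> = 0"
  proof (intro sum.neutral ballI)
    fix k assume "k \<in> {..m}"
    then show "coeff F k * ((\<Sum>i<N. w i * y i ^ k) - (\<Sum>i<N. w i * x i ^ k)) = 0"
      using eq[of k] by (cases "k = 0") auto
  qed
  finally show False by simp
qed

lemma exists_threshold:
  fixes c :: "nat \<Rightarrow> real"
  assumes "mono_on {..<s} c" "\<forall>j\<in>{..<s}. c j \<noteq> t"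
  shows "\<exists>l\<le>s. (\<forall>j<l. c j < t) \<and> (\<forall>j. l \<le> j \<longrightarrow> j < s \<longrightarrow> t < c j) \<and>
    {j \<in> {..<s}. t < c j} = {l..<s}"
proof -
  define l where "l = (LEAST j. j = s \<or> (j < s \<and> t < c j))"
  have l: "l = s \<or> (l < s \<and> t < c l)" unfolding l_def by (rule LeastI[of _ s]) simp
  have least: "\<not> (j = s \<or> (j < s \<and> t < c j))" if "j < l" for j
    using that unfolding l_def by (rule not_less_Least)
  have 1: "c j < t" if "j < l" for j
    using least[OF that] assms(2) that l by (metis lessThan_iff less_trans linorder_neqE_linordered_idom)
  have 2: "t < c j" if "l \<le> j" "j < s" for j
    using that l monotone_onD[OF assms(1), of l j] by auto
  have "{j \<in> {..<s}. t < c j} = {l..<s}"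
    using 1 2 by (auto simp: not_less[symmetric]) (meson less_asym not_le)
  then show ?thesis using l 1 2 by (intro exI[of _ l]) auto
qed

lemma mono_on_lessThanI:
  fixes c :: "nat \<Rightarrow> real"
  assumes "\<And>j. Suc j < s \<Longrightarrow> c j \<le> c (Suc j)"
  shows "mono_on {..<s} c"
proof (rule monotone_onI)
  fix i j assume "i \<in> {..<s}" "j \<in> {..<s}" "i \<le> j"
  from \<open>i \<le> j\<close> \<open>j \<in> {..<s}\<close> show "c i \<le> c j"
  proof (induction j rule: dec_induct)
    case (step j)
    then show ?case using assms[of j] by simp
  qed simp
qed

text \<open>The polynomial \<open>q\<close> is minus the product of the \<open>T - c\<^sub>j\<close>. The roots \<open>c\<^sub>j = x\<^sub>j\<close> at the possibly
  multiple values let \<open>q\<close> change from negative to positive there, as needed when the matching entries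
  of \<open>Y\<close> spread to both sides. Between two of these, \<open>q\<close> must change back; this happens at the entry of
  \<open>Y\<close> that is matched with the simple value \<open>x\<^sub>j\<close>, clipped to the neighbouring values so that the \<open>c\<^sub>j\<close>
  stay ordered. A wrong sign of \<open>q\<close> at a point between \<open>X\<^sub>i\<close> and \<open>Y\<^sub>i\<close> would contradict the monotonicity
  of \<open>Y\<close>. As \<open>q\<close> has degree \<open>s\<close> and leading coefficient \<open>-1\<close>, the sum of the increments of its
  antiderivative is a negative multiple of the difference of the power sums of order \<open>s + 1\<close>.\<close>
lemma power_sum_less_of_alternating_simple_roots:
  fixes x X Y :: "nat \<Rightarrow> real"
  assumes s: "1 \<le> s"
    and X: "mono_on {..<n} X" and Y: "mono_on {..<n} Y"
    and x: "strict_mono_on {..<s} x" and image: "X ` {..<n} = x ` {..<s}"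
    and simple: "\<And>j. j < s \<Longrightarrow> odd (s - j) \<Longrightarrow> \<exists>!i. i < n \<and> X i = x j"
    and eq: "\<And>k. k \<in> {1..s} \<Longrightarrow> power_sum n Y k = power_sum n X k"
    and ne: "\<exists>i<n. X i \<noteq> Y i"
  shows "power_sum n Y (s + 1) < power_sum n X (s + 1)"
proof -
  obtain ix where ix: "\<And>j. j < s \<Longrightarrow> odd (s - j) \<Longrightarrow> ix j < n \<and> X (ix j) = x j \<and> (\<forall>i<n. X i = x j \<longrightarrow> i = ix j)"
    using simple by metis
  have ix_less: "ix j < n" and X_ix: "X (ix j) = x j" if "j < s" "odd (s - j)" for j
    using ix[OF that] by blast+
  have ix_unique: "i = ix j" if "X i = x j" "i < n" "j < s" "odd (s - j)" for i j
    using ix[OF that(3,4)] that(1,2) by blast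
  have monoX: "X i \<le> X j" and monoY: "Y i \<le> Y j" if "i \<le> j" "j < n" for i j
    using X Y that by (auto simp: monotone_on_def)
  have less_x: "x i < x j" if "i < j" "j < s" for i j
    using x that by (auto simp: monotone_on_def)
  have less_x_iff: "x i < x j \<longleftrightarrow> i < j" if "i < s" "j < s" for i j
    using less_x[of i j] less_x[of j i] that by (metis linorder_neqE_nat less_asym less_irrefl)
  \<comment> \<open>The index parity is counted from the top: \<open>s - j\<close> is odd for the largest value \<open>x (s - 1)\<close>. 
      The clipping is one-sided at the two ends.\<close>
  define v where "v j = (if j = 0 then Y (ix j) else max (Y (ix j)) (x (j - 1)))" for j
  define c where "c j = (if odd (s - j) then (if Suc j = s then v j else min (v j) (x (Suc j))) else x j)" for j
  have "c j \<le> c (Suc j)" if "Suc j < s" for j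
  proof (cases "odd (s - j)")
    case True
    then have "even (s - Suc j)" using that by (simp add: Suc_diff_Suc[symmetric])
    then show ?thesis using True that by (simp add: c_def)
  next
    case False
    then have "odd (s - Suc j)" using that by (metis Suc_diff_Suc Suc_lessD even_Suc)
    then show ?thesis using False that less_x[of j "Suc (Suc j)"] by (auto simp: c_def v_def)
  qed
  then have c_mono: "mono_on {..<s} c"
    by (rule mono_on_lessThanI)
  define q where "q = - (\<Prod>j<s. [:- c j, 1:])"
  have q_eval: "poly q t = - (\<Prod>j<s. t - c j)" for t by (simp add: q_def poly_prod)
  have deg_q: "degree q = s" by (simp add: q_def degree_prod_eq_sum_degree)
  have lead_q: "coeff q s = - 1"
    using lead_coeff_prod[of "\<lambda>j. [:- c j, 1:]" "{..<s}"] deg_q by (simp add: q_def)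
  have below: "i \<le> ix j" if "X i \<le> x j" "i < n" "j < s" "odd (s - j)" for i j
  proof (rule ccontr)
    assume *: "\<not> i \<le> ix j"
    have "X i = x j" using monoX[of "ix j" i] ix_less[OF that(3,4)] X_ix[OF that(3,4)] that(1,2) * by linarith
    then show False using ix_unique that(2-4) * by blast
  qed
  have above: "ix j \<le> i" if "x j \<le> X i" "i < n" "j < s" "odd (s - j)" for i j
  proof (rule ccontr)
    assume *: "\<not> ix j \<le> i"
    have "X i = x j" using monoX[of i "ix j"] ix_less[OF that(3,4)] X_ix[OF that(3,4)] that(1,2) * by linarith
    then show False using ix_unique that(2-4) * by blast
  qed
  have pos: "poly q t \<ge> 0" if i: "i < n" and t: "X i < t" "t < Y i" for i t
  proof (rule ccontr)
    assume "\<not> poly q t \<ge> 0"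
    then have prod: "(\<Prod>j<s. t - c j) > 0" by (simp add: q_eval)
    then have "(\<Prod>j<s. t - c j) \<noteq> 0" by linarith
    then have c_ne: "\<forall>j\<in>{..<s}. c j \<noteq> t" by auto
    obtain l where l: "l \<le> s" "\<forall>j<l. c j < t" "\<forall>j. l \<le> j \<longrightarrow> j < s \<longrightarrow> t < c j"
      "{j \<in> {..<s}. t < c j} = {l..<s}"
      using exists_threshold[OF c_mono c_ne] by blast
    have ev: "even (s - l)" using prod prod_diff_pos_iff[OF _ c_ne] l(4) by simp
    obtain j where j: "j < s" "X i = x j" using image i by blast
    have t_less: "t < x l" if "l < s"
    proof -
      have "c l = x l" using ev by (simp add: c_def)
      then show ?thesis using l(3) that by auto
    qed
    \<comment> \<open>The point t lies above c at the simple value m = l - 1 and below the next multiple value, if there is one.\<close>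
    have jl: "j < l"
    proof (cases "l = s")
      case False
      then have "t < x l" using t_less l(1) by simp
      then show ?thesis using t j l(1) False less_x_iff[of j l] by simp
    qed (use j in simp)
    define m where "m = l - 1"
    have m: "m < s" "Suc m = l" "odd (s - m)" using jl l(1) ev by (auto simp: m_def)
    have "X i \<le> x m" using j m jl less_x_iff[of m j] by (metis less_Suc_eq_le not_le)
    then have "Y i \<le> Y (ix m)" using below[of i m] i m monoY ix_less[of m] by simp
    then have "t < v m" using t by (auto simp: v_def)
    moreover have "Suc m = s \<or> t < x l" using l(1) m(2) t_less by (cases "l = s") auto
    ultimately have "t < c m" using m by (auto simp: c_def)
    moreover have "c m < t" using l(2) m(2) by blast
    ultimately show False by simp
  qed
  have neg: "poly q t \<le> 0" if i: "i < n" and t: "Y i < t" "t < X i" for i t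
  proof (rule ccontr)
    assume "\<not> poly q t \<le> 0"
    then have prod: "(\<Prod>j<s. t - c j) < 0" by (simp add: q_eval)
    then have "(\<Prod>j<s. t - c j) \<noteq> 0" by linarith
    then have c_ne: "\<forall>j\<in>{..<s}. c j \<noteq> t" by auto
    obtain l where l: "l \<le> s" "\<forall>j<l. c j < t" "\<forall>j. l \<le> j \<longrightarrow> j < s \<longrightarrow> t < c j"
      "{j \<in> {..<s}. t < c j} = {l..<s}"
      using exists_threshold[OF c_mono c_ne] by blast
    have ev: "odd (s - l)" using prod prod_diff_pos_iff[OF _ c_ne] l(4) by simp
    then have ls: "l < s" using l(1) by (cases "l = s") auto
    obtain j where j: "j < s" "X i = x j" using image i by blast
    have prev: "x (l - 1) < t" if "l > 0"
    proof -
      have "even (s - (l - 1))" using ev that ls by auto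
      then have "c (l - 1) = x (l - 1)" by (simp add: c_def)
      moreover have "c (l - 1) < t" using l(2) that by simp
      ultimately show ?thesis by simp
    qed
    have "l \<le> j"
    proof (cases "l = 0")
      case False
      then have "x (l - 1) < x j" using prev t j by simp
      then have "l - 1 < j" using less_x_iff[of "l - 1" j] j ls by simp
      then show ?thesis by simp
    qed simp
    then have "x l \<le> X i" using j ls less_x_iff[of j l] by (metis not_le)
    then have "Y (ix l) \<le> Y i" using above[of l i] i ls ev monoY by simp
    then have "v l < t" using t prev by (auto simp: v_def)
    then have "c l < t" using ev by (auto simp: c_def)
    moreover have "t < c l" using l(3) ls by blast
    ultimately show False by simp
  qed
  obtain F where F: "pderiv F = q" using poly_antiderivative by blast
  have degF: "degree F \<le> s + 1" using degree_le_Suc_degree_pderiv[of F] deg_q F by simp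
  have leadF: "real (s + 1) * coeff F (s + 1) = - 1"
    using coeff_pderiv[of F s] lead_q F by simp
  have "0 < (\<Sum>i<n. 1 * (poly F (Y i) - poly F (X i)))"
  proof (rule weighted_increments_pos)
    show "pderiv F \<noteq> 0" using F lead_q by auto
  qed (use pos neg ne F in auto)
  also have "\<dots> = (\<Sum>k\<le>s+1. coeff F k * (power_sum n Y k - power_sum n X k))"
    using weighted_increments_eq[OF degF, of "\<lambda>_. 1" Y X "{..<n}"] by (simp add: power_sum_def)
  also have "\<dots> = (\<Sum>k\<in>{s+1}. coeff F k * (power_sum n Y k - power_sum n X k))"
  proof (rule sum.mono_neutral_right)
    show "\<forall>k\<in>{..s+1} - {s+1}. coeff F k * (power_sum n Y k - power_sum n X k) = 0"
    proof
      fix k assume "k \<in> {..s+1} - {s+1}"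
      then show "coeff F k * (power_sum n Y k - power_sum n X k) = 0"
        using eq[of k] by (cases "k = 0") (auto simp: power_sum_def)
    qed
  qed auto
  finally have "coeff F (s + 1) * (power_sum n Y (s + 1) - power_sum n X (s + 1)) > 0" by simp
  moreover have "coeff F (s + 1) < 0"
  proof (rule ccontr)
    assume "\<not> coeff F (s + 1) < 0"
    then have "0 \<le> real (s + 1) * coeff F (s + 1)" by (intro mult_nonneg_nonneg) auto
    then show False using leadF by linarith
  qed
  ultimately show ?thesis by (simp add: zero_less_mult_iff)
qed

section \<open>Realising and maximising power sums\<close>

lemma compact_PiE_UNIV:
  fixes S :: "'i \<Rightarrow> real set"
  assumes "\<And>i. compact (S i)"
  shows "compact (PiE UNIV S)"
proof -
  have "compactin (product_topology (\<lambda>_. euclidean) UNIV) (PiE UNIV S)"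
    using assms by (simp add: compactin_PiE)
  then show ?thesis by (simp add: euclidean_product_topology)
qed

lemma continuous_on_coordinate: "continuous_on A (\<lambda>x::nat \<Rightarrow> real. x i)"
  by (rule continuous_on_subset[OF continuous_on_product_coordinates]) simp

lemma strict_mono_on_lessThanI:
  fixes c :: "nat \<Rightarrow> real"
  assumes "\<And>j. Suc j < s \<Longrightarrow> c j < c (Suc j)"
  shows "strict_mono_on {..<s} c"
proof (rule monotone_onI)
  fix i j assume "i \<in> {..<s}" "j \<in> {..<s}" "i < j"
  from \<open>i < j\<close> \<open>j \<in> {..<s}\<close> show "c i < c j"
  proof (induction j)
    case (Suc j)
    then show ?case using assms[of j] by (cases "i = j") auto
  qed simp
qed

text \<open>The points are found by least squares on a small box around \<open>x0\<close>. On the boundary of the box the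
  power sums stay away from those of \<open>x0\<close>, because they determine the points
  (\<open>sorted_determined_by_power_sums\<close>). For targets close to those of \<open>x0\<close> the minimiser is therefore
  an interior point. There the gradient vanishes, which says that the polynomial with coefficients
  \<open>k * r k\<close> formed from the residuals \<open>r\<close> vanishes at \<open>s\<close> distinct points. As its degree is less than
  \<open>s\<close>, all residuals are zero.\<close>
lemma weighted_power_sums_reach_nearby_values:
  fixes w x0 :: "nat \<Rightarrow> real"
  assumes s: "1 \<le> s" and w: "\<And>i. i < s \<Longrightarrow> w i > 0" and x0: "strict_mono_on {..<s} x0"
  defines "W \<equiv> \<lambda>x k. \<Sum>i<s. w i * x i ^ k"
  shows "\<exists>\<delta>>0. \<forall>\<tau>. \<bar>\<tau> - W x0 s\<bar> < \<delta> \<longrightarrow>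
    (\<exists>x. strict_mono_on {..<s} x \<and> (\<forall>k\<in>{1..<s}. W x k = W x0 k) \<and> W x s = \<tau>)"
proof -
  obtain \<eta> where \<eta>: "\<eta> > 0" and sep: "\<And>a b. a \<in> x0 ` {..<s} \<Longrightarrow> b \<in> x0 ` {..<s} \<Longrightarrow> a \<noteq> b \<Longrightarrow> 2 * \<eta> \<le> \<bar>a - b\<bar>"
    using exists_separation[of "x0 ` {..<s}"] by blast
  define h where "h = \<eta> / 2"
  have h: "h > 0" using \<eta> by (simp add: h_def)
  define K where "K = PiE UNIV (\<lambda>i. if i < s then {x0 i - h..x0 i + h} else {x0 i})"
  have K_iff: "x \<in> K \<longleftrightarrow> (\<forall>i. if i < s then \<bar>x i - x0 i\<bar> \<le> h else x i = x0 i)" for x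
    unfolding K_def by (auto simp: PiE_iff abs_le_iff split: if_splits)
  have K_mono: "strict_mono_on {..<s} x" if "x \<in> K" for x
  proof (rule strict_mono_on_lessThanI)
    fix j assume j: "Suc j < s"
    have "x0 j < x0 (Suc j)" using x0 j by (auto simp: monotone_on_def)
    then have "2 * \<eta> \<le> x0 (Suc j) - x0 j" using sep[of "x0 j" "x0 (Suc j)"] j by auto
    moreover have "\<bar>x j - x0 j\<bar> \<le> h" "\<bar>x (Suc j) - x0 (Suc j)\<bar> \<le> h"
      using that j unfolding K_iff by (metis Suc_lessD)+
    ultimately show "x j < x (Suc j)" using \<eta> unfolding h_def abs_le_iff by linarith
  qed
  have K_compact: "compact K" unfolding K_def by (intro compact_PiE_UNIV) auto
  define B where "B = K \<inter> (\<Union>i<s. {x. \<bar>x i - x0 i\<bar> = h})"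
  have "compact B" unfolding B_def
    by (intro compact_Int_closed K_compact closed_UN ballI closed_Collect_eq continuous_intros
          continuous_on_coordinate) auto
  have "x0(0 := x0 0 + h) \<in> B" using s h by (auto simp: B_def K_iff intro!: bexI[of _ 0])
  have W_cont: "continuous_on A (\<lambda>x. W x k)" for A k
    unfolding W_def by (intro continuous_intros continuous_on_coordinate)
  define d where "d x = (\<Sum>k\<in>{1..s}. (W x k - W x0 k)\<^sup>2)" for x
  have "continuous_on B d" unfolding d_def by (intro continuous_intros W_cont)
  then obtain xb where xb: "xb \<in> B" "\<And>x. x \<in> B \<Longrightarrow> d xb \<le> d x"
    using continuous_attains_inf[OF \<open>compact B\<close>] \<open>x0(0 := x0 0 + h) \<in> B\<close> by blast
  have "d xb \<noteq> 0"
  proof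
    assume "d xb = 0"
    then have eq: "\<forall>k\<in>{1..s}. W xb k = W x0 k" by (simp add: d_def sum_nonneg_eq_0_iff)
    let ?D = "{i. Suc i < s \<and> (x0 i \<noteq> x0 (Suc i) \<or> xb i \<noteq> xb (Suc i))}"
    have "card ?D \<le> card {..<s - 1}" by (intro card_mono) auto
    then have "card ?D < s" using s by simp
    then have "\<forall>i<s. x0 i = xb i"
      using eq w K_mono[of xb] xb(1) x0
      by (intro sorted_determined_by_power_sums[where m = s and w = w])
         (auto simp: W_def B_def intro: strict_mono_on_imp_mono_on)
    then show False using xb(1) h by (auto simp: B_def)
  qed
  moreover have "d xb \<ge> 0" unfolding d_def by (intro sum_nonneg) simp
  ultimately have m: "d xb > 0" by simp
  define \<delta> where "\<delta> = sqrt (d xb) / 2"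
  have "\<exists>x. strict_mono_on {..<s} x \<and> (\<forall>k\<in>{1..<s}. W x k = W x0 k) \<and> W x s = \<tau>"
    if \<tau>: "\<bar>\<tau> - W x0 s\<bar> < \<delta>" for \<tau>
  proof -
    define e where "e = \<tau> - W x0 s"
    have "e\<^sup>2 < \<delta>\<^sup>2" using \<tau> by (metis e_def abs_ge_zero power2_abs power_strict_mono zero_less_numeral)
    then have e: "e\<^sup>2 < d xb / 4" using m by (simp add: \<delta>_def power_divide)
    define T where "T k = (if k = s then \<tau> else W x0 k)" for k
    define \<Psi> where "\<Psi> x = (\<Sum>k\<in>{1..s}. (W x k - T k)\<^sup>2)" for x
    have delta: "(\<Sum>k\<in>{1..s}. if k = s then e\<^sup>2 else 0) = e\<^sup>2" using s by simp
    have "\<Psi> x0 = (\<Sum>k\<in>{1..s}. if k = s then e\<^sup>2 else 0)"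
      unfolding \<Psi>_def by (intro sum.cong) (auto simp: T_def e_def power2_commute)
    then have \<Psi>0: "\<Psi> x0 = e\<^sup>2" using delta by simp
    have \<Psi>B: "\<Psi> x > e\<^sup>2" if "x \<in> B" for x
    proof -
      have "(W x k - W x0 k)\<^sup>2 / 2 - (if k = s then e\<^sup>2 else 0) \<le> (W x k - T k)\<^sup>2" for k
      proof (cases "k = s")
        case True
        \<comment> \<open>This is \<open>(u - e)\<^sup>2 \<ge> u\<^sup>2 / 2 - e\<^sup>2\<close> for \<open>u = W x s - W x0 s\<close>.\<close>
        have "0 \<le> (W x s - W x0 s - 2 * e)\<^sup>2" by simp
        then have "(W x s - W x0 s)\<^sup>2 / 2 - e\<^sup>2 \<le> (W x s - W x0 s - e)\<^sup>2"
          by (simp add: power2_eq_square field_simps)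
        then show ?thesis using True by (simp add: T_def e_def)
      qed (simp add: T_def)
      then have "(\<Sum>k\<in>{1..s}. (W x k - W x0 k)\<^sup>2 / 2 - (if k = s then e\<^sup>2 else 0)) \<le> \<Psi> x"
        unfolding \<Psi>_def by (intro sum_mono)
      then have "d x / 2 - e\<^sup>2 \<le> \<Psi> x"
        unfolding sum_subtractf delta by (simp add: d_def sum_divide_distrib)
      then show ?thesis using xb(2)[OF that] e by linarith
    qed
    have "x0 \<in> K" using h by (simp add: K_iff)
    have "continuous_on K \<Psi>" unfolding \<Psi>_def by (intro continuous_intros W_cont)
    then obtain x where x: "x \<in> K" "\<And>y. y \<in> K \<Longrightarrow> \<Psi> x \<le> \<Psi> y"
      using continuous_attains_inf[OF K_compact] \<open>x0 \<in> K\<close> by blast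
    have "x \<notin> B" using \<Psi>B[of x] x(2)[OF \<open>x0 \<in> K\<close>] \<Psi>0 by force
    then have inner: "\<bar>x i - x0 i\<bar> < h" if "i < s" for i
      using x(1) that by (force simp: B_def K_iff less_le)
    define r where "r k = W x k - T k" for k
    have grad: "(\<Sum>k\<in>{1..s}. real k * r k * x i ^ (k - 1)) = 0" if i: "i < s" for i
    proof -
      define C where "C k = (\<Sum>j\<in>{..<s} - {i}. w j * x j ^ k)" for k
      have upd: "W (x(i := v)) k = w i * v ^ k + C k" for v k
        using i by (simp add: W_def C_def sum.remove[of "{..<s}" i])
      have "((\<lambda>v. \<Sum>k\<in>{1..s}. (w i * v ^ k + C k - T k)\<^sup>2) has_real_derivative
          (\<Sum>k\<in>{1..s}. 2 * (w i * x i ^ k + C k - T k) * (w i * (real k * x i ^ (k - 1))))) (at (x i))"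
        by (intro DERIV_sum) (auto intro!: derivative_eq_intros)
      moreover have "(\<lambda>v. \<Sum>k\<in>{1..s}. (w i * v ^ k + C k - T k)\<^sup>2) = (\<lambda>v. \<Psi> (x(i := v)))"
        by (simp add: \<Psi>_def upd)
      moreover have "w i * x i ^ k + C k - T k = r k" for k
        using upd[of "x i" k] by (simp add: r_def)
      ultimately have deriv: "((\<lambda>v. \<Psi> (x(i := v))) has_real_derivative
          (\<Sum>k\<in>{1..s}. 2 * r k * (w i * (real k * x i ^ (k - 1))))) (at (x i))" by simp
      have "(\<Sum>k\<in>{1..s}. 2 * r k * (w i * (real k * x i ^ (k - 1)))) = 0"
      proof (rule DERIV_local_min[OF deriv])
        show "0 < h - \<bar>x i - x0 i\<bar>" using inner[OF i] by simp
        show "\<forall>v. \<bar>x i - v\<bar> < h - \<bar>x i - x0 i\<bar> \<longrightarrow> \<Psi> (x(i := x i)) \<le> \<Psi> (x(i := v))"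
        proof (intro allI impI)
          fix v assume "\<bar>x i - v\<bar> < h - \<bar>x i - x0 i\<bar>"
          then have "\<bar>v - x0 i\<bar> \<le> h" by linarith
          then have "x(i := v) \<in> K" using x(1) i by (auto simp: K_iff)
          then show "\<Psi> (x(i := x i)) \<le> \<Psi> (x(i := v))" using x(2) by simp
        qed
      qed
      also have "(\<Sum>k\<in>{1..s}. 2 * r k * (w i * (real k * x i ^ (k - 1)))) =
          2 * w i * (\<Sum>k\<in>{1..s}. real k * r k * x i ^ (k - 1))"
        by (simp add: sum_distrib_left mult_ac)
      finally show ?thesis using w[OF i] by simp
    qed
    define Q where "Q = (\<Sum>k\<in>{1..s}. monom (real k * r k) (k - 1))"
    have "Q = 0"
    proof (rule ccontr)
      assume Q: "Q \<noteq> 0"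
      have "degree Q \<le> s - 1" unfolding Q_def
        by (intro degree_sum_le order.trans[OF degree_monom_le]) auto
      moreover have "x ` {..<s} \<subseteq> {t. poly Q t = 0}"
        using grad by (auto simp: Q_def poly_sum poly_monom)
      then have "card (x ` {..<s}) \<le> card {t. poly Q t = 0}"
        using poly_roots_finite[OF Q] by (intro card_mono)
      moreover have "card (x ` {..<s}) = s"
        using strict_mono_on_imp_inj_on[OF K_mono[OF x(1)]] by (simp add: card_image)
      ultimately show False using card_poly_roots_bound[OF Q] s by linarith
    qed
    have "r k = 0" if k: "k \<in> {1..s}" for k
    proof -
      have "coeff Q (k - 1) = (\<Sum>j\<in>{1..s}. if j = k then real j * r j else 0)"
        unfolding Q_def coeff_sum using k by (intro sum.cong) auto
      then show ?thesis using k \<open>Q = 0\<close> by simp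
    qed
    then have "W x k = T k" if "k \<in> {1..s}" for k using that by (simp add: r_def)
    then show ?thesis using K_mono[OF x(1)] s by (intro exI[of _ x]) (auto simp: T_def)
  qed
  moreover have "\<delta> > 0" using m by (simp add: \<delta>_def)
  ultimately show ?thesis by blast
qed

text \<open>For \<open>s \<ge> 2\<close> the sum of squares is fixed, which bounds the entries.\<close>
lemma exists_maximal_power_sum:
  assumes s: "2 \<le> s"
  shows "\<exists>y. (\<forall>k\<in>{1..s}. power_sum n y k = power_sum n x k) \<and>
    (\<forall>z. (\<forall>k\<in>{1..s}. power_sum n z k = power_sum n x k) \<longrightarrow> power_sum n z (s + 1) \<le> power_sum n y (s + 1))"
proof -
  define R where "R = sqrt (power_sum n x 2)"
  define K where "K = PiE UNIV (\<lambda>i. if i < n then {- R..R} else {0}) \<inter>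
    (\<Inter>k\<in>{1..s}. {z. power_sum n z k = power_sum n x k})"
  have cont: "continuous_on A (\<lambda>z. power_sum n z k)" for A k
    unfolding power_sum_def by (intro continuous_intros continuous_on_coordinate)
  have "compact K" unfolding K_def
    by (intro compact_Int_closed compact_PiE_UNIV closed_INT ballI closed_Collect_eq continuous_intros cont) auto
  \<comment> \<open>Only the first n entries enter the power sums; setting the others to zero makes the set compact.\<close>
  define tr where "tr z i = (if i < n then z i else 0)" for z :: "nat \<Rightarrow> real" and i
  have tr: "power_sum n (tr z) k = power_sum n z k" for z k by (simp add: power_sum_def tr_def)
  have tr_K: "tr z \<in> K" if z: "\<forall>k\<in>{1..s}. power_sum n z k = power_sum n x k" for z
  proof -
    have "\<bar>z i\<bar> \<le> R" if "i < n" for i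
    proof -
      have "(z i)\<^sup>2 \<le> power_sum n z 2" unfolding power_sum_def
        using that by (intro member_le_sum) auto
      then have "(z i)\<^sup>2 \<le> power_sum n x 2" using z s by simp
      then show ?thesis unfolding R_def by (metis real_sqrt_abs real_sqrt_le_mono)
    qed
    then have "- R \<le> z i" "z i \<le> R" if "i < n" for i
      using that by (force simp: abs_le_iff)+
    then have "tr z \<in> PiE UNIV (\<lambda>i. if i < n then {- R..R} else {0})"
      by (simp add: PiE_iff tr_def)
    then show ?thesis using z by (simp add: K_def tr)
  qed
  have "tr x \<in> K" by (intro tr_K) simp
  then obtain y where y: "y \<in> K" "\<And>z. z \<in> K \<Longrightarrow> power_sum n z (s + 1) \<le> power_sum n y (s + 1)"
    using continuous_attains_sup[OF \<open>compact K\<close> _ cont[of K "s + 1"]] by blast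
  then show ?thesis
    using tr_K tr by (intro exI[of _ y]) (auto simp: K_def, metis)
qed

section \<open>Patterns of multiplicities and generic slices\<close>

lemma exists_block_map:
  fixes a :: "nat \<Rightarrow> nat"
  shows "\<exists>b::nat \<Rightarrow> nat. mono_on {..<\<Sum>j<s. a j} b \<and> (\<forall>i<\<Sum>j<s. a j. b i < s) \<and>
    (\<forall>j<s. card {i. i < (\<Sum>j<s. a j) \<and> b i = j} = a j)"
proof (induction s)
  case (Suc s)
  define n where "n = (\<Sum>j<s. a j)"
  obtain b where b: "mono_on {..<n} b" "\<forall>i<n. b i < s" "\<forall>j<s. card {i. i < n \<and> b i = j} = a j"
    using Suc unfolding n_def by blast
  define b' where "b' i = (if i < n then b i else s)" for i
  have sum: "(\<Sum>j<Suc s. a j) = n + a s" by (simp add: n_def)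
  have "mono_on {..<n + a s} b'"
    using b(1,2) by (auto simp: monotone_on_def b'_def less_imp_le)
  moreover have "\<forall>i<n + a s. b' i < Suc s" using b(2) by (auto simp: b'_def less_Suc_eq)
  moreover have "card {i. i < n + a s \<and> b' i = j} = a j" if "j < Suc s" for j
  proof (cases "j < s")
    case True
    then have "{i. i < n + a s \<and> b' i = j} = {i. i < n \<and> b i = j}" by (auto simp: b'_def)
    then show ?thesis using b(3) True by simp
  next
    case False
    then have "j = s" using that by simp
    have last: "b' i = s \<longleftrightarrow> n \<le> i" for i
      using b(2) unfolding b'_def by (metis less_irrefl not_less)
    have "{i. i < n + a s \<and> b' i = j} = {n..<n + a s}"
      unfolding \<open>j = s\<close> last by auto
    then show ?thesis using \<open>j = s\<close> by simp
  qed
  ultimately show ?case unfolding sum by blast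
qed (simp add: monotone_on_def)

lemma power_sum_blocks:
  fixes b :: "nat \<Rightarrow> nat"
  assumes "\<forall>i<n. b i < s"
  shows "power_sum n (x \<circ> b) k = (\<Sum>j<s. real (card {i. i < n \<and> b i = j}) * x j ^ k)"
proof -
  have "power_sum n (x \<circ> b) k = (\<Sum>j<s. \<Sum>i\<in>{i \<in> {..<n}. b i = j}. (x \<circ> b) i ^ k)"
    unfolding power_sum_def using assms by (intro sum.group[symmetric]) auto
  also have "\<dots> = (\<Sum>j<s. \<Sum>i\<in>{i \<in> {..<n}. b i = j}. x j ^ k)"
    by (intro sum.cong) auto
  finally show ?thesis by simp
qed

lemma card_jumps_less_card_image:
  fixes y :: "nat \<Rightarrow> real"
  assumes "mono_on {..<n} y" "n > 0"
  shows "card {i. Suc i < n \<and> y i \<noteq> y (Suc i)} < card (y ` {..<n})"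
proof -
  let ?E = "{i. Suc i < n \<and> y i \<noteq> y (Suc i)}"
  have mono: "y i \<le> y j" if "i \<le> j" "j < n" for i j
    using assms(1) that by (auto simp: monotone_on_def)
  have jump: "y i < y (Suc i)" if "i \<in> ?E" for i
    using that mono[of i "Suc i"] by simp
  have less: "y (Suc i) < y (Suc j)" if "i \<in> ?E" "j \<in> ?E" "i < j" for i j
    using mono[of "Suc i" j] jump[OF that(2)] that by simp
  have "inj_on (\<lambda>i. y (Suc i)) ?E"
  proof (rule inj_onI)
    fix i j assume "i \<in> ?E" "j \<in> ?E" "y (Suc i) = y (Suc j)"
    then show "i = j" using less[of i j] less[of j i] by (cases i j rule: linorder_cases) auto
  qed
  moreover have "(\<lambda>i. y (Suc i)) ` ?E \<subseteq> y ` {..<n} - {y 0}"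
  proof
    fix t assume "t \<in> (\<lambda>i. y (Suc i)) ` ?E"
    then obtain i where i: "i \<in> ?E" "t = y (Suc i)" by blast
    have "y 0 < y (Suc i)" using mono[of 0 i] jump[OF i(1)] i(1) by simp
    then show "t \<in> y ` {..<n} - {y 0}" using i by auto
  qed
  then have "card ((\<lambda>i. y (Suc i)) ` ?E) \<le> card (y ` {..<n} - {y 0})"
    by (intro card_mono) auto
  ultimately have "card ?E \<le> card (y ` {..<n} - {y 0})"
    by (simp only: card_image)
  also have "\<dots> < card (y ` {..<n})"
    using assms(2) by (intro psubset_card_mono) auto
  finally show ?thesis .
qed

text \<open>The set of jumps of a monotone sequence has fewer elements than there are distinct values. Hence, by
  \<open>sorted_determined_by_power_sums\<close>, the sequences considered here are determined by their sets of
  jumps, of which there are finitely many.\<close>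
lemma finite_power_sums_few_distinct:
  assumes "n > 0"
  shows "finite {power_sum n y s |y. mono_on {..<n} y \<and> card (y ` {..<n}) < s \<and>
    (\<forall>k\<in>{1..<s}. power_sum n y k = p k)}"
proof -
  define Ys where "Ys = {y. mono_on {..<n} y \<and> card (y ` {..<n}) < s \<and>
    (\<forall>k\<in>{1..<s}. power_sum n y k = p k)}"
  define jumps where "jumps y = {i. Suc i < n \<and> y i \<noteq> y (Suc i)}" for y :: "nat \<Rightarrow> real"
  have det: "power_sum n y s = power_sum n z s" if y: "y \<in> Ys" and z: "z \<in> Ys" and eq: "jumps y = jumps z" for y z
  proof -
    have "{i. Suc i < n \<and> (y i \<noteq> y (Suc i) \<or> z i \<noteq> z (Suc i))} = jumps y"
      using eq by (auto simp: jumps_def)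
    then have card: "card {i. Suc i < n \<and> (y i \<noteq> y (Suc i) \<or> z i \<noteq> z (Suc i))} < card (y ` {..<n})"
      using card_jumps_less_card_image[of n y] y assms by (simp add: jumps_def Ys_def)
    have "\<forall>i<n. y i = z i"
    proof (rule sorted_determined_by_power_sums[OF _ _ _ card, of "\<lambda>_. 1"])
      fix k assume "k \<in> {1..card (y ` {..<n})}"
      then have "power_sum n y k = p k" "power_sum n z k = p k" using y z by (auto simp: Ys_def)
      then show "(\<Sum>i<n. 1 * z i ^ k) = (\<Sum>i<n. 1 * y i ^ k)" by (simp add: power_sum_def)
    qed (use y z in \<open>auto simp: Ys_def\<close>)
    then show ?thesis by (simp add: power_sum_def)
  qed
  define rep where "rep e = (SOME y. y \<in> Ys \<and> jumps y = e)" for e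
  have "power_sum n y s \<in> (\<lambda>e. power_sum n (rep e) s) ` Pow {..<n}" if "y \<in> Ys" for y
  proof (rule image_eqI)
    have "rep (jumps y) \<in> Ys \<and> jumps (rep (jumps y)) = jumps y"
      unfolding rep_def by (rule someI[of _ y]) (use that in simp)
    then show "power_sum n y s = power_sum n (rep (jumps y)) s" using det[OF that] by simp
  qed (auto simp: jumps_def)
  then have "(\<lambda>y. power_sum n y s) ` Ys \<subseteq> (\<lambda>e. power_sum n (rep e) s) ` Pow {..<n}" by blast
  then have "finite ((\<lambda>y. power_sum n y s) ` Ys)" by (rule finite_subset) simp
  moreover have "(\<lambda>y. power_sum n y s) ` Ys = {power_sum n y s |y. mono_on {..<n} y \<and> card (y ` {..<n}) < s \<and>
    (\<forall>k\<in>{1..<s}. power_sum n y k = p k)}" by (auto simp: Ys_def)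
  ultimately show ?thesis by simp
qed

lemma exists_enumeration_of_mset:
  assumes "finite I" "size r = card I"
  shows "\<exists>a. image_mset a (mset_set I) = r"
  using assms
proof (induction I arbitrary: r rule: finite_induct)
  case (insert i I)
  then obtain c r' where r: "r = add_mset c r'" by (metis card_insert_disjoint size_eq_Suc_imp_eq_union)
  then obtain a where a: "image_mset a (mset_set I) = r'" using insert by force
  have "image_mset (a(i := c)) (mset_set I) = image_mset a (mset_set I)"
    using insert.hyps by (intro image_mset_cong) auto
  then have "image_mset (a(i := c)) (mset_set (insert i I)) = r"
    using insert.hyps r a by (simp del: fun_upd_apply add: fun_upd_same)
  then show ?case by blast
qed simp

lemma card_odd_distance: "card {j. j < s \<and> odd (s - j)} = (s + 1) div 2"
proof (induction s rule: nat_less_induct)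
  case (1 s)
  show ?case
  proof (cases "s < 2")
    case True
    then consider "s = 0" | "s = 1" by linarith
    then show ?thesis by cases (auto simp: less_Suc_eq intro: arg_cong[of _ "{0}" card, simplified])
  next
    case False
    then obtain m where s: "s = Suc (Suc m)" by (metis Suc_diff_Suc Suc_1 diff_zero not_less less_Suc_eq numeral_2_eq_2 old.nat.exhaust)
    have "{j. j < s \<and> odd (s - j)} = insert (Suc m) {j. j < m \<and> odd (m - j)}"
      by (auto simp: s less_Suc_eq Suc_diff_le)
    moreover have "card {j. j < m \<and> odd (m - j)} = (m + 1) div 2" using 1 s by simp
    ultimately show ?thesis by (simp add: s)
  qed
qed

text \<open>Arranging the ones at every second place, counted from the top, yields a multiplicity pattern to which
  \<open>power_sum_less_of_alternating_simple_roots\<close> applies.\<close>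
lemma exists_alternating_arrangement:
  fixes q :: "nat multiset"
  assumes "size q = s" "s \<le> 2 * count q 1"
  shows "\<exists>a. image_mset a (mset_set {..<s}) = q \<and> (\<forall>j<s. odd (s - j) \<longrightarrow> a j = 1)"
proof -
  define Od where "Od = {j. j < s \<and> odd (s - j)}"
  have Od: "finite Od" "Od \<subseteq> {..<s}" by (auto simp: Od_def)
  have "card Od \<le> count q 1" using assms(2) card_odd_distance[of s] unfolding Od_def by linarith
  then obtain r where r: "q = replicate_mset (card Od) 1 + r"
    by (metis count_le_replicate_mset_subset_eq subset_mset.add_diff_inverse)
  have "size r = card ({..<s} - Od)"
    using assms(1) Od by (simp add: r card_Diff_subset)
  then obtain a where a: "image_mset a (mset_set ({..<s} - Od)) = r"
    using exists_enumeration_of_mset by blast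
  define a' where "a' j = (if j \<in> Od then 1 else a j)" for j
  have "{..<s} = Od \<union> ({..<s} - Od)" using Od by blast
  then have "mset_set {..<s} = mset_set Od + mset_set ({..<s} - Od)"
    using Od by (metis Diff_disjoint finite_Diff finite_lessThan mset_set_Union)
  moreover have "image_mset a' (mset_set Od) = image_mset (\<lambda>_. 1) (mset_set Od)"
    using Od by (intro image_mset_cong) (simp add: a'_def)
  moreover have "image_mset a' (mset_set ({..<s} - Od)) = r"
    unfolding a[symmetric] using Od by (intro image_mset_cong) (simp add: a'_def)
  ultimately have "image_mset a' (mset_set {..<s}) = q" by (simp add: r image_mset_const_eq)
  then show ?thesis by (intro exI[of _ a']) (simp add: a'_def Od_def)
qed

text \<open>Starting from the roots \<open>0, \<dots>, s - 1\<close> with multiplicities arranged alternately, move the roots such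
  that the power sums of order less than \<open>s\<close> are kept and the one of order \<open>s\<close> avoids the finitely
  many values attained with fewer distinct roots. The resulting slice is generic, and its polynomial with
  the given multiplicities is minimal.\<close>
lemma pattern_in_P_min:
  assumes s: "1 \<le> s" "s \<le> n" and q: "q \<in> partitions_into n s" "s \<le> 2 * count q 1"
  shows "q \<in> P_min n s"
proof -
  have size: "size q = s" and sum: "sum_mset q = n" and pos: "\<forall>k\<in>#q. 0 < k"
    using q(1) by (auto simp: partitions_into_def)
  obtain a where a: "image_mset a (mset_set {..<s}) = q" "\<And>j. j < s \<Longrightarrow> odd (s - j) \<Longrightarrow> a j = 1"
    using exists_alternating_arrangement[OF size q(2)] by blast
  have a_pos: "a j > 0" if "j < s" for j using pos that unfolding a(1)[symmetric] by simp
  have a_sum: "(\<Sum>j<s. a j) = n" using sum unfolding a(1)[symmetric] by (simp add: sum_unfold_sum_mset)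
  obtain b where b: "mono_on {..<n} b" "\<forall>i<n. b i < s" "\<And>j. j < s \<Longrightarrow> card {i. i < n \<and> b i = j} = a j"
    using exists_block_map[of a s] unfolding a_sum by blast
  have b_image: "b ` {..<n} = {..<s}"
  proof
    show "{..<s} \<subseteq> b ` {..<n}"
    proof
      fix j assume "j \<in> {..<s}"
      then have "{i. i < n \<and> b i = j} \<noteq> {}" using b(3)[of j] a_pos[of j] by (metis card.empty lessThan_iff less_irrefl)
      then show "j \<in> b ` {..<n}" by auto
    qed
  qed (use b in auto)
  have ps: "power_sum n (x \<circ> b) k = (\<Sum>j<s. real (a j) * x j ^ k)" for x k
    using power_sum_blocks[OF b(2)] b(3) by simp
  \<comment> \<open>The values of the power sum of order s that spoil genericity.\<close>
  define Z where "Z = {power_sum n y s |y. mono_on {..<n} y \<and> card (y ` {..<n}) < s \<and>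
    (\<forall>k\<in>{1..<s}. power_sum n y k = power_sum n (real \<circ> b) k)}"
  have "finite Z" unfolding Z_def by (rule finite_power_sums_few_distinct) (use s in simp)
  obtain \<delta> where \<delta>: "\<delta> > 0" "\<And>\<tau>. \<bar>\<tau> - power_sum n (real \<circ> b) s\<bar> < \<delta> \<Longrightarrow>
      \<exists>x. strict_mono_on {..<s} x \<and> (\<forall>k\<in>{1..<s}. power_sum n (x \<circ> b) k = power_sum n (real \<circ> b) k) \<and>
        power_sum n (x \<circ> b) s = \<tau>"
    using weighted_power_sums_reach_nearby_values[of s "\<lambda>j. real (a j)" real] s(1) a_pos
    unfolding ps by (auto simp: monotone_on_def)
  let ?c = "power_sum n (real \<circ> b) s"
  have "infinite ({?c - \<delta><..<?c + \<delta>} - Z)"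
    using \<open>finite Z\<close> \<delta>(1) by (intro Diff_infinite_finite) (auto simp: infinite_Ioo)
  then obtain \<tau> where \<tau>: "\<tau> \<in> {?c - \<delta><..<?c + \<delta>}" "\<tau> \<notin> Z"
    by (metis Diff_iff finite.emptyI ex_in_conv)
  have "\<bar>\<tau> - ?c\<bar> < \<delta>" using \<tau>(1) by auto
  then obtain x where x: "strict_mono_on {..<s} x"
    "\<And>k. k \<in> {1..<s} \<Longrightarrow> power_sum n (x \<circ> b) k = power_sum n (real \<circ> b) k"
    "power_sum n (x \<circ> b) s = \<tau>" using \<delta>(2) by blast
  define X where "X = x \<circ> b"
  define H where "H = roots_poly n X"
  have inj: "inj_on x {..<s}" using x(1) by (rule strict_mono_on_imp_inj_on)
  have X_mono: "mono_on {..<n} X"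
  proof (rule monotone_onI)
    fix i j assume "i \<in> {..<n}" "j \<in> {..<n}" "i \<le> j"
    then have "b i \<le> b j" "b i \<in> {..<s}" "b j \<in> {..<s}" using b(1,2) by (auto simp: monotone_on_def)
    then show "X i \<le> X j"
      using monotone_onD[OF strict_mono_on_imp_mono_on[OF x(1)]] by (simp add: X_def)
  qed
  have X_image: "X ` {..<n} = x ` {..<s}" unfolding X_def image_comp[symmetric] b_image ..
  have X_fibre: "{i. i < n \<and> X i = x j} = {i. i < n \<and> b i = j}" if "j < s" for j
    using b(2) that inj_onD[OF inj] by (auto simp: X_def)
  have H: "H \<in> hyperbolic_polys n" unfolding H_def by (rule roots_poly_in_hyperbolic_polys)
  have slice: "\<exists>y. mono_on {..<n} y \<and> G = roots_poly n y \<and> (\<forall>k\<in>{1..s}. power_sum n y k = power_sum n X k)"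
    if G: "G \<in> hyperbolic_slice n s H" for G
  proof -
    have "G \<in> hyperbolic_polys n" using G by (simp add: hyperbolic_slice_def)
    then obtain y where y: "mono_on {..<n} y" "G = roots_poly n y" by (rule hyperbolic_polys_sorted)
    then show ?thesis using G roots_poly_in_slice_iff[OF s(2), of y X] by (auto simp: H_def)
  qed
  have "generic_slice n s H"
    unfolding generic_slice_def
  proof (intro ballI notI)
    fix G assume G: "G \<in> hyperbolic_slice n s H" "card {x. poly G x = 0} \<le> s - 1"
    obtain y where y: "mono_on {..<n} y" "G = roots_poly n y" "\<forall>k\<in>{1..s}. power_sum n y k = power_sum n X k"
      using slice[OF G(1)] by blast
    have "card (y ` {..<n}) < s" using G(2) s(1) by (simp add: y(2) roots_poly_zeros)
    moreover have "\<forall>k\<in>{1..<s}. power_sum n y k = power_sum n (real \<circ> b) k"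
      using y(3) x(2) by (simp add: X_def)
    ultimately have "power_sum n y s \<in> Z" using y(1) unfolding Z_def by blast
    moreover have "power_sum n y s = \<tau>" using y(3) s(1) x(3) by (simp add: X_def)
    ultimately show False using \<tau>(2) by simp
  qed
  moreover have "minimal_in_slice n s H H"
    unfolding minimal_in_slice_def
  proof (intro conjI impI ballI)
    show "H \<in> hyperbolic_slice n s H" using H by (simp add: hyperbolic_slice_def)
    fix G assume "s < n" and G: "G \<in> hyperbolic_slice n s H"
    obtain y where y: "mono_on {..<n} y" "G = roots_poly n y" "\<forall>k\<in>{1..s}. power_sum n y k = power_sum n X k"
      using slice[OF G] by blast
    have "power_sum n y (s + 1) \<le> power_sum n X (s + 1)"
    proof (cases "\<exists>i<n. X i \<noteq> y i")
      case True
      have "\<exists>!i. i < n \<and> X i = x j" if "j < s" "odd (s - j)" for j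
      proof -
        have "card {i. i < n \<and> X i = x j} = 1"
          using X_fibre[OF that(1)] b(3)[OF that(1)] a(2)[OF that] by simp
        then obtain i where "{i. i < n \<and> X i = x j} = {i}" by (rule card_1_singletonE)
        then have "i < n \<and> X i = x j" "\<And>k. k < n \<and> X k = x j \<Longrightarrow> k = i"
          unfolding set_eq_iff mem_Collect_eq singleton_iff by simp_all
        then show ?thesis by (rule ex1I)
      qed
      then show ?thesis
        using power_sum_less_of_alternating_simple_roots[OF s(1) X_mono y(1) x(1) X_image _ _ True] y(3)
        by (simp add: less_imp_le)
    next
      case False
      then show ?thesis by (simp add: power_sum_def)
    qed
    then show "coeff H (n - (s + 1)) \<le> coeff G (n - (s + 1))"
      unfolding H_def y(2) next_coeff_le_iff[OF \<open>s < n\<close> y(3)] .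
  qed
  moreover have "root_partition H = q"
  proof -
    have "root_partition H = image_mset (\<lambda>t. card {i. i < n \<and> X i = t}) (image_mset x (mset_set {..<s}))"
      unfolding H_def root_partition_roots_poly X_image image_mset_mset_set[OF inj] ..
    also have "\<dots> = image_mset a (mset_set {..<s})"
      unfolding image_mset.compositionality
      by (intro image_mset_cong) (simp add: X_fibre b(3))
    finally show ?thesis using a(1) by simp
  qed
  ultimately show ?thesis using H q(1) unfolding P_min_def by blast
qed

text \<open>Every part different from one is at least two.\<close>
lemma twice_size_le_sum_plus_ones:
  "\<forall>k\<in>#q. 0 < k \<Longrightarrow> 2 * size q \<le> sum_mset q + count q (1::nat)"
  by (induction q) auto

lemma count_root_partition_1:
  assumes "G \<noteq> 0"
  shows "count (root_partition G) 1 = card {x. poly G x = 0 \<and> order x G = 1}"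
  using poly_roots_finite[OF assms]
  by (simp add: root_partition_def count_image_mset vimage_def Int_def conj_commute)

lemma P_min_eq:
  assumes s: "1 \<le> s" "s \<le> n"
  shows "P_min n s = {q \<in> partitions_into n s. s \<le> 2 * count q 1}"
proof
  show "{q \<in> partitions_into n s. s \<le> 2 * count q 1} \<subseteq> P_min n s"
    using pattern_in_P_min[OF s] by blast
  show "P_min n s \<subseteq> {q \<in> partitions_into n s. s \<le> 2 * count q 1}"
  proof
    fix q assume "q \<in> P_min n s"
    then obtain F H where q: "q \<in> partitions_into n s" and H: "minimal_in_slice n s F H" "q = root_partition H"
      by (auto simp: P_min_def)
    have "s \<le> 2 * count q 1"
    proof (cases "s < n")
      case True
      have hyp: "H \<in> hyperbolic_polys n" using H(1) by (simp add: minimal_in_slice_def hyperbolic_slice_def)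
      have "degree H = n" using hyp by (simp add: hyperbolic_polys_def)
      then have "H \<noteq> 0" using True by auto
      have "card {x. poly H x = 0} = s"
        using root_partition_in_partitions[OF hyp] q H(2) by (simp add: partitions_into_def)
      then show ?thesis
        using minimal_in_slice_card_roots[OF H(1) True] count_root_partition_1[OF \<open>H \<noteq> 0\<close>] H(2) by simp
    next
      case False
      then show ?thesis using twice_size_le_sum_plus_ones[of q] q s by (auto simp: partitions_into_def)
    qed
    then show "q \<in> {q \<in> partitions_into n s. s \<le> 2 * count q 1}" using q by simp
  qed
qed

section \<open>Refining partitions and the covering property\<close>

lemma partition_le_refl: "\<forall>k\<in>#p. 0 < k \<Longrightarrow> partition_le p p"
  unfolding partition_le_def
  by (intro exI[of _ "image_mset (\<lambda>k. {#k#}) p"]) (auto simp: image_mset.compositionality comp_def)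

lemma partition_le_merge:
  assumes "partition_le (add_mset c (add_mset d p)) q"
  shows "partition_le (add_mset (c + d) p) q"
proof -
  obtain M where M: "{#} \<notin># M" "sum_mset M = q" "image_mset sum_mset M = add_mset c (add_mset d p)"
    using assms by (auto simp: partition_le_def)
  obtain g M1 where g: "M = add_mset g M1" "sum_mset g = c" "image_mset sum_mset M1 = add_mset d p"
    using M(3) by (metis msed_map_invR)
  obtain h M2 where h: "M1 = add_mset h M2" "sum_mset h = d" "image_mset sum_mset M2 = p"
    using g(3) by (metis msed_map_invR)
  show ?thesis unfolding partition_le_def
    using M g h by (intro exI[of _ "add_mset (g + h) M2"]) (auto simp: add_ac)
qed

text \<open>Each step splits a part \<open>c \<ge> 2\<close> into \<open>c - 1\<close> and \<open>1\<close>. It increases both the number of parts and,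
  by at least one, the number of ones, which preserves the inequality.\<close>
lemma exists_refinement_with_many_ones:
  assumes "p \<in> partitions_into n k" "k \<le> s" "s \<le> n" "2 * k \<le> s + 2 * count p 1"
  shows "\<exists>q\<in>partitions_into n s. s \<le> 2 * count q 1 \<and> partition_le p q"
  using assms
proof (induction "s - k" arbitrary: p k)
  case 0
  then have "k = s" by simp
  then show ?case using 0 partition_le_refl[of p] by (intro bexI[of _ p]) (auto simp: partitions_into_def)
next
  case (Suc d)
  have p: "\<forall>k\<in>#p. 0 < k" "sum_mset p = n" "size p = k" using Suc.prems by (auto simp: partitions_into_def)
  have "k < n" using Suc by linarith
  have "\<exists>c\<in>#p. 2 \<le> c"
  proof (rule ccontr)
    assume "\<not> (\<exists>c\<in>#p. 2 \<le> c)"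
    then have "\<forall>c\<in>#p. c = 1" using p(1) by (metis One_nat_def Suc_1 Suc_leI le_antisym not_less_eq_eq)
    then have "sum_mset p = size p" by (induction p) auto
    then show False using p \<open>k < n\<close> by simp
  qed
  then obtain c p0 where c: "p = add_mset c p0" "2 \<le> c" by (metis multi_member_split)
  define p' where "p' = add_mset (c - 1) (add_mset 1 p0)"
  have "p' \<in> partitions_into n (Suc k)" using p c by (auto simp: p'_def partitions_into_def)
  moreover have "count p 1 + 1 \<le> count p' 1" using c by (auto simp: p'_def)
  then have "2 * (count p 1 + 1) \<le> 2 * count p' 1" by (rule mult_le_mono2)
  then have "2 * Suc k \<le> s + 2 * count p' 1" using Suc.prems(4) by simp
  moreover have "d = s - Suc k" "Suc k \<le> s" using Suc.hyps(2) by linarith+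
  ultimately obtain q where q: "q \<in> partitions_into n s" "s \<le> 2 * count q 1" "partition_le p' q"
    using Suc.hyps(1)[of "Suc k" p'] Suc.prems(3) by blast
  have "c - 1 + 1 = c" using c by simp
  then have "partition_le p q" using partition_le_merge[of "c - 1" 1 p0 q] q(3) by (simp add: p'_def c)
  then show ?case using q by blast
qed

text \<open>For \<open>s < n\<close> take a minimal polynomial. It exists because \<open>s \<ge> 2\<close>. For \<open>s = n\<close> the
  polynomial \<open>F\<close> itself qualifies, since a polynomial of degree \<open>n\<close> with few simple roots has few roots.\<close>
lemma exists_few_roots_in_slice:
  assumes s: "1 \<le> s" "s \<le> n" "s = 1 \<longrightarrow> n = 1" and F: "F \<in> hyperbolic_polys n"
  shows "\<exists>G\<in>hyperbolic_slice n s F. card {x. poly G x = 0} \<le> s \<and>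
    2 * card {x. poly G x = 0} \<le> s + 2 * count (root_partition G) 1"
proof -
  obtain x where x: "F = roots_poly n x" using F by (rule hyperbolic_polys_sorted)
  show ?thesis
  proof (cases "s = n")
    case True
    have "card {x. poly F x = 0} \<le> n"
      using card_image_le[of "{..<n}" x] by (simp add: x roots_poly_zeros)
    moreover have "2 * card {x. poly F x = 0} \<le> n + count (root_partition F) 1"
      using twice_size_le_sum_plus_ones[of "root_partition F"] root_partition_in_partitions[OF F]
      by (simp add: partitions_into_def)
    moreover have "F \<in> hyperbolic_slice n s F" using F by (simp add: hyperbolic_slice_def)
    ultimately show ?thesis using True by (intro bexI[of _ F]) auto
  next
    case False
    then have sn: "s < n" "2 \<le> s" using s by auto
    obtain y where y: "\<forall>k\<in>{1..s}. power_sum n y k = power_sum n x k"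
      "\<And>z. \<forall>k\<in>{1..s}. power_sum n z k = power_sum n x k \<Longrightarrow> power_sum n z (s + 1) \<le> power_sum n y (s + 1)"
      using exists_maximal_power_sum[OF sn(2), of n x] by blast
    define G where "G = roots_poly n y"
    have G: "G \<in> hyperbolic_slice n s F" using y(1) roots_poly_in_slice_iff[OF s(2)] by (simp add: G_def x)
    have min: "minimal_in_slice n s F G" unfolding minimal_in_slice_def
    proof (intro conjI impI ballI G)
      fix H assume H: "H \<in> hyperbolic_slice n s F"
      then have "H \<in> hyperbolic_polys n" by (simp add: hyperbolic_slice_def)
      then obtain z where z: "H = roots_poly n z" by (rule hyperbolic_polys_sorted)
      have zx: "\<forall>k\<in>{1..s}. power_sum n z k = power_sum n x k"
        using H roots_poly_in_slice_iff[OF s(2), of z x] by (simp add: z x)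
      then have "\<forall>k\<in>{1..s}. power_sum n z k = power_sum n y k" using y(1) by simp
      from next_coeff_le_iff[OF sn(1) this] y(2)[OF zx]
      show "coeff G (n - (s + 1)) \<le> coeff H (n - (s + 1))" by (simp add: G_def z)
    qed
    have "G \<noteq> 0" by (simp add: G_def roots_poly_nonzero)
    then show ?thesis
      using G minimal_in_slice_card_roots[OF min sn(1)] count_root_partition_1 by (intro bexI[of _ G]) simp_all
  qed
qed

lemma card_patterns:
  assumes "s \<le> n"
  shows "card {q \<in> partitions_into n s. s \<le> 2 * count q 1} =
    card (partitions_into (n - (s + 1) div 2) (s div 2))"
proof -
  let ?c = "(s + 1) div 2"
  have c: "?c \<le> s" "s - ?c = s div 2" by linarith+
  have "bij_betw (\<lambda>p. p + replicate_mset ?c 1) (partitions_into (n - ?c) (s div 2))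
      {q \<in> partitions_into n s. s \<le> 2 * count q 1}"
  proof (rule bij_betwI[where g = "\<lambda>q. q - replicate_mset ?c 1"])
    show "(\<lambda>p. p + replicate_mset ?c 1) \<in> partitions_into (n - ?c) (s div 2) \<rightarrow>
        {q \<in> partitions_into n s. s \<le> 2 * count q 1}"
    proof
      fix p assume p: "p \<in> partitions_into (n - ?c) (s div 2)"
      have "sum_mset (p + replicate_mset ?c 1) = n"
        using p c assms unfolding partitions_into_def by simp
      moreover have "size (p + replicate_mset ?c 1) = s"
        using p unfolding partitions_into_def by simp
      moreover have "\<forall>k\<in>#p + replicate_mset ?c 1. 0 < k"
        using p by (auto simp: partitions_into_def dest: in_replicate_mset[THEN iffD1])
      moreover have "s \<le> 2 * count (p + replicate_mset ?c 1) 1" by simp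
      ultimately show "p + replicate_mset ?c 1 \<in> {q \<in> partitions_into n s. s \<le> 2 * count q 1}"
        unfolding partitions_into_def by blast
    qed
    have sub: "replicate_mset ?c 1 \<subseteq># q" if "s \<le> 2 * count q 1" for q :: "nat multiset"
    proof -
      have "?c \<le> count q 1" using that by linarith
      then show ?thesis by (simp add: count_le_replicate_mset_subset_eq)
    qed
    show "(\<lambda>q. q - replicate_mset ?c 1) \<in> {q \<in> partitions_into n s. s \<le> 2 * count q 1} \<rightarrow>
        partitions_into (n - ?c) (s div 2)"
    proof
      fix q assume q: "q \<in> {q \<in> partitions_into n s. s \<le> 2 * count q 1}"
      then obtain r where r: "q = replicate_mset ?c 1 + r"
        using sub by (metis (mono_tags, lifting) mem_Collect_eq subset_mset.add_diff_inverse)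
      show "q - replicate_mset ?c 1 \<in> partitions_into (n - ?c) (s div 2)"
        unfolding partitions_into_def mem_Collect_eq
      proof (intro conjI)
        show "\<forall>k\<in>#q - replicate_mset ?c 1. 0 < k"
          using q by (auto simp: r partitions_into_def)
        have "sum_mset q = n" "size q = s" using q by (simp_all only: partitions_into_def mem_Collect_eq)
        then have "?c + sum_mset r = n" "?c + size r = s" unfolding r by simp_all
        then show "sum_mset (q - replicate_mset ?c 1) = n - ?c" "size (q - replicate_mset ?c 1) = s div 2"
          using c(2) unfolding r add_diff_cancel_left' by linarith+
      qed
    qed
    show "q - replicate_mset ?c 1 + replicate_mset ?c 1 = q"
      if "q \<in> {q \<in> partitions_into n s. s \<le> 2 * count q 1}" for q
    proof (rule subset_mset.diff_add[OF sub])
      show "s \<le> 2 * count q 1" using that by blast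
    qed
  qed (rule add_diff_cancel_right')
  then show ?thesis by (rule bij_betw_same_card[symmetric])
qed

theorem theorem4p4:
  fixes n s :: nat
  assumes "1 \<le> s" and "s \<le> n"
  shows "((s = 1 \<longrightarrow> n = 1) \<longrightarrow> vandermonde_covering n s (P_min n s)) \<and>
    card (P_min n s) = card (partitions_into (n - nat \<lceil>real s / 2\<rceil>) (nat \<lfloor>real s / 2\<rfloor>))"
proof (intro conjI impI)
  have "nat \<lceil>real s / 2\<rceil> = (s + 1) div 2" "nat \<lfloor>real s / 2\<rfloor> = s div 2" by linarith+
  then show "card (P_min n s) = card (partitions_into (n - nat \<lceil>real s / 2\<rceil>) (nat \<lfloor>real s / 2\<rfloor>))"
    using card_patterns[OF assms(2)] P_min_eq[OF assms] by simp
next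
  assume s1: "s = 1 \<longrightarrow> n = 1"
  show "vandermonde_covering n s (P_min n s)"
    unfolding vandermonde_covering_def
  proof (intro conjI ballI)
    show "P_min n s \<subseteq> partitions_into n s" by (auto simp: P_min_def)
    fix F assume F: "F \<in> hyperbolic_polys n"
    obtain G where G: "G \<in> hyperbolic_slice n s F" "card {x. poly G x = 0} \<le> s"
      "2 * card {x. poly G x = 0} \<le> s + 2 * count (root_partition G) 1"
      using exists_few_roots_in_slice[OF assms s1 F] by blast
    have "G \<in> hyperbolic_polys n" using G(1) by (simp add: hyperbolic_slice_def)
    then obtain q where "q \<in> partitions_into n s" "s \<le> 2 * count q 1" "partition_le (root_partition G) q"
      using exists_refinement_with_many_ones[OF root_partition_in_partitions G(2) assms(2) G(3)] by blast
    then show "\<exists>q\<in>P_min n s. \<exists>G\<in>hyperbolic_slice n s F. partition_le (root_partition G) q"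
      using G(1) P_min_eq[OF assms] by blast
  qed
qed

end
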